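(* Let $A\in\mathbb{R}^{n\times n}$, $B\in\mathbb{R}^{n\times m}$, $C=\{C_i\}_{i=1}^d\subset\mathbb{R}^{n\times n}$, $D=\{D_i\}_{i=1}^d\subset\mathbb{R}^{n\times m}$ be constant matrices, and let $T>0$ and $\delta\in[0,1)$. The following statements are equivalent: (i) There exists a filtered probability space $\mathfrak{T}(w,\mathbb{P})$ such that the system $[A^\top,B^\top,C^\top,D^\top,\mathfrak{T}(w,\mathbb{P})]_T$ is $\delta$-observable. (ii) For any filtered probability space $\mathfrak{T}(w,\mathbb{P})$, the system $[A^\top,B^\top,C^\top,D^\top,\mathfrak{T}(w,\mathbb{P})]_T$ is $\delta$-observable. Furthermore, if there exists a filtered probability space $\mathfrak{T}(w,\mathbb{P})$ such that $[A^\top,B^\top,C^\top,D^\top,\mathfrak{T}(w,\mathbb{P})]_T$ is $\delta$-observable, then the quantity $$\mathcal{O}_{op}(\delta,T,\mathfrak{T}(w,\mathbb{P})):=\inf\Big\{c\ge 0:\ E_{\mathbb{P}}|y^w(0;y_1)|^2_{\mathbb{R}^n}\le c\,E_{\mathbb{P}}\int_0^T|z^w(t;y_1)|^2_{\mathbb{R}^m}dt+\delta E_{\mathbb{P}}|y_1|^2_{\mathbb{R}^n}\ \ \forall\, y_1\in L^2_{\mathcal{F}^w_T}(\Omega,\mathbb{P};\mathbb{R}^n)\Big\}$$ is independent of $\mathfrak{T}(w,\mathbb{P})$ (it takes the same value for every filtered probability space).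
   Context: Filtered probability spaces. A measurable space $(\Omega,\mathcal{F})$ is fixed. For a probability measure $\mathbb{P}$ on it (with expectation $E_{\mathbb{P}}$) and a $d$-dimensional standard Brownian motion $w=(w^1,\dots,w^d)^\top$ on $(\Omega,\mathcal{F},\mathbb{P})$, $\{\mathcal{F}^w_t\}_{t\ge0}$ is the natural filtration of $w$ (augmented by the $\mathbb{P}$-null sets), and $\mathfrak{T}(w,\mathbb{P})$ denotes the filtered probability space $(\Omega,\mathcal{F},\{\mathcal{F}^w_t\}_{t\ge0},\mathbb{P})$. "There exists/for any filtered probability space" means there exist/for any such $\mathbb{P}$ and $w$; it is assumed that at least one such pair exists. Spaces. $L^2_{\mathcal{F}^w_T}(\Omega,\mathbb{P};\mathbb{R}^n)$ is the space of $\mathcal{F}^w_T$-measurable square-integrable $\mathbb{R}^n$-valued random variables. $L^2_{\mathfrak{T}(w,\mathbb{P})}(0,T;\mathbb{R}^n)$ is the space of $\{\mathcal{F}^w_t\}$-progressively measurable processes $\xi$ with $E_{\mathbb{P}}\int_0^T|\xi(t)|^2dt<\infty$. $C_{\mathfrak{T}(w,\mathbb{P})}([0,T];\mathbb{R}^n)$ is the space of $\{\mathcal{F}^w_t\}$-adapted processes continuous from $[0,T]$ to $L^2_{\mathcal{F}^w_T}(\Omega,\mathbb{P};\mathbb{R}^n)$. Dual-observation system. $[A^\top,B^\top,C^\top,D^\top,\mathfrak{T}(w,\mathbb{P})]_T$ is the backward stochastic differential equation with output $$dy(t)=\Big(-A^\top y(t)-\sum_{i=1}^dC_i^\top Y_i(t)\Big)dt+\sum_{i=1}^dY_i(t)dw^i(t),\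 t\in[0,T],\quad y(T)=y_1\in L^2_{\mathcal{F}^w_T}(\Omega,\mathbb{P};\mathbb{R}^n),$$ $$z(t)=B^\top y(t)+\sum_{i=1}^dD_i^\top Y_i(t),\quad t\in[0,T].$$ Its unique solution in $C_{\mathfrak{T}(w,\mathbb{P})}([0,T];\mathbb{R}^n)\times(L^2_{\mathfrak{T}(w,\mathbb{P})}(0,T;\mathbb{R}^n))^d$, together with the output, is denoted $(y^w(\cdot;y_1),(Y^w_i(\cdot;y_1))_{i=1}^d,z^w(\cdot;y_1))$. $\delta$-observability. For $T>0$ and $\delta\in[0,1)$, $[A^\top,B^\top,C^\top,D^\top,\mathfrak{T}(w,\mathbb{P})]_T$ is $\delta$-observable if there is a constant $c(\delta,T)>0$ such that $$E_{\mathbb{P}}|y^w(0;y_1)|^2_{\mathbb{R}^n}\le c(\delta,T)E_{\mathbb{P}}\int_0^T|z^w(t;y_1)|^2_{\mathbb{R}^m}dt+\delta E_{\mathbb{P}}|y_1|^2_{\mathbb{R}^n}\quad\text{for any }y_1\in L^2_{\mathcal{F}^w_T}(\Omega,\mathbb{P};\mathbb{R}^n).$$ *)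

theory Defs
  imports "HOL-Probability.Probability"
begin

text \<open>
  Processes are functions \<open>real \<Rightarrow> 'w \<Rightarrow> _\<close>, time first; only their values at nonnegative times
  matter. Random variables are functions, not equivalence classes, so identities between them are
  stated almost everywhere.
\<close>

section \<open>Filtered probability spaces generated by a Brownian motion\<close>

definition natural_sigma :: "'w measure \<Rightarrow> (real \<Rightarrow> 'w \<Rightarrow> real^'d) \<Rightarrow> real \<Rightarrow> 'w measure" where
  "natural_sigma P w t =
     sigma (space P) {w s -` A \<inter> space P | s A. s \<in> {0..t} \<and> A \<in> sets borel}"

text \<open>
  The density below is that of the centred Gaussian law with covariance matrix \<open>(t - s) I\<close>; the
  second argument of \<^const>\<open>normal_density\<close> is the standard deviation.
\<close>

definition standard_brownian_motion :: "'w measure \<Rightarrow> (real \<Rightarrow> 'w \<Rightarrow> real^'d) \<Rightarrow> bool" where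
  "standard_brownian_motion P w \<longleftrightarrow>
     prob_space P \<and>
     (\<forall>t\<ge>0. w t \<in> borel_measurable P) \<and>
     (AE \<omega> in P. w 0 \<omega> = 0) \<and>
     (AE \<omega> in P. continuous_on {0..} (\<lambda>t. w t \<omega>)) \<and>
     (\<forall>s t. 0 \<le> s \<and> s < t \<longrightarrow>
        distributed P lborel (\<lambda>\<omega>. w t \<omega> - w s \<omega>)
          (\<lambda>x. ennreal (\<Prod>i\<in>UNIV. normal_density 0 (sqrt (t - s)) (x $ i))) \<and>
        prob_space.indep_set P
          (sets (natural_sigma P w s))
          (sets (vimage_algebra (space P) (\<lambda>\<omega>. w t \<omega> - w s \<omega>) borel)))"

text \<open>
  The pair \<open>(P, w)\<close> ranges over the filtered probability spaces on the measurable space underlying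
  \<open>N\<close>; the measure carried by \<open>N\<close> itself plays no role.
\<close>

definition filtered_prob_space :: "'w measure \<Rightarrow> 'w measure \<Rightarrow> (real \<Rightarrow> 'w \<Rightarrow> real^'d) \<Rightarrow> bool" where
  "filtered_prob_space N P w \<longleftrightarrow> sets P = sets N \<and> standard_brownian_motion P w"

text \<open>The null sets added are the \<open>P\<close>-null events of the given sigma-algebra.\<close>

definition brownian_filtration :: "'w measure \<Rightarrow> (real \<Rightarrow> 'w \<Rightarrow> real^'d) \<Rightarrow> real \<Rightarrow> 'w measure" where
  "brownian_filtration P w t =
     sigma (space P) (sets (natural_sigma P w t) \<union> null_sets P)"


section \<open>Spaces of random variables and processes\<close>

definition L2_rv :: "'w measure \<Rightarrow> (real \<Rightarrow> 'w \<Rightarrow> real^'d) \<Rightarrow> real \<Rightarrow> ('w \<Rightarrow> real^'n) set" where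
  "L2_rv P w T =
     {\<xi>. \<xi> \<in> borel_measurable (brownian_filtration P w T) \<and> integrable P (\<lambda>\<omega>. (norm (\<xi> \<omega>))\<^sup>2)}"

definition progressive ::
  "'w measure \<Rightarrow> (real \<Rightarrow> 'w \<Rightarrow> real^'d) \<Rightarrow> real \<Rightarrow> (real \<Rightarrow> 'w \<Rightarrow> real^'n) \<Rightarrow> bool" where
  "progressive P w T \<xi> \<longleftrightarrow>
     (\<forall>t\<in>{0..T}. (\<lambda>(s, \<omega>). \<xi> s \<omega>)
        \<in> borel_measurable (restrict_space borel {0..t} \<Otimes>\<^sub>M brownian_filtration P w t))"

definition L2_proc ::
  "'w measure \<Rightarrow> (real \<Rightarrow> 'w \<Rightarrow> real^'d) \<Rightarrow> real \<Rightarrow> (real \<Rightarrow> 'w \<Rightarrow> real^'n) set" where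
  "L2_proc P w T =
     {\<xi>. progressive P w T \<xi> \<and>
         (\<integral>\<^sup>+\<omega>. (\<integral>\<^sup>+s\<in>{0..T}. ennreal ((norm (\<xi> s \<omega>))\<^sup>2) \<partial>lborel) \<partial>P) < \<infinity>}"

definition C_proc ::
  "'w measure \<Rightarrow> (real \<Rightarrow> 'w \<Rightarrow> real^'d) \<Rightarrow> real \<Rightarrow> (real \<Rightarrow> 'w \<Rightarrow> real^'n) set" where
  "C_proc P w T =
     {\<xi>. (\<forall>t\<in>{0..T}. \<xi> t \<in> borel_measurable (brownian_filtration P w t)) \<and>
         (\<forall>t\<in>{0..T}. \<xi> t \<in> L2_rv P w T) \<and>
         (\<forall>t\<in>{0..T}. ((\<lambda>s. \<integral>\<omega>. (norm (\<xi> s \<omega> - \<xi> t \<omega>))\<^sup>2 \<partial>P) \<longlongrightarrow> 0) (at t within {0..T}))}"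


section \<open>The Ito integral\<close>

text \<open>
  The integrand with data \<open>(K, \<tau>, \<phi>)\<close> is the step process equal to \<open>\<phi> j\<close> on the interval
  \<open>{\<tau> j <.. \<tau> (Suc j)}\<close>, for \<open>j < K\<close>.
\<close>

definition simple_integrand ::
  "'w measure \<Rightarrow> (real \<Rightarrow> 'w \<Rightarrow> real^'d) \<Rightarrow> real \<Rightarrow> nat \<Rightarrow> (nat \<Rightarrow> real) \<Rightarrow> (nat \<Rightarrow> 'w \<Rightarrow> real^'n) \<Rightarrow> bool"
where
  "simple_integrand P w t K \<tau> \<phi> \<longleftrightarrow>
     \<tau> 0 = 0 \<and> \<tau> K = t \<and> (\<forall>j<K. \<tau> j \<le> \<tau> (Suc j)) \<and>
     (\<forall>j<K. \<phi> j \<in> borel_measurable (brownian_filtration P w (\<tau> j)) \<and>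
            (\<exists>b. \<forall>\<omega>\<in>space P. norm (\<phi> j \<omega>) \<le> b))"

definition simple_process ::
  "nat \<Rightarrow> (nat \<Rightarrow> real) \<Rightarrow> (nat \<Rightarrow> 'w \<Rightarrow> real^'n) \<Rightarrow> real \<Rightarrow> 'w \<Rightarrow> real^'n" where
  "simple_process K \<tau> \<phi> s \<omega> = (\<Sum>j<K. indicator {\<tau> j <.. \<tau> (Suc j)} s *\<^sub>R \<phi> j \<omega>)"

definition simple_ito_integral ::
  "(real \<Rightarrow> 'w \<Rightarrow> real^'d) \<Rightarrow> 'd \<Rightarrow> nat \<Rightarrow> (nat \<Rightarrow> real) \<Rightarrow> (nat \<Rightarrow> 'w \<Rightarrow> real^'n) \<Rightarrow> 'w \<Rightarrow> real^'n"
where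
  "simple_ito_integral w i K \<tau> \<phi> \<omega> = (\<Sum>j<K. (w (\<tau> (Suc j)) \<omega> $ i - w (\<tau> j) \<omega> $ i) *\<^sub>R \<phi> j \<omega>)"

text \<open>
  \<open>has_ito_integral P w i \<xi> t X\<close> says that \<open>X\<close> is (a version of) the integral of \<open>\<xi>\<close> over \<open>{0..t}\<close>
  with respect to the component \<open>i\<close> of \<open>w\<close>: it is the mean-square limit of the integrals of simple
  integrands that converge to \<open>\<xi>\<close> in mean square. By the Ito isometry such an \<open>X\<close> is almost surely
  unique, and it exists for every \<open>\<xi>\<close> in \<open>L2_proc P w t\<close>.
\<close>

definition has_ito_integral ::
  "'w measure \<Rightarrow> (real \<Rightarrow> 'w \<Rightarrow> real^'d) \<Rightarrow> 'd \<Rightarrow> (real \<Rightarrow> 'w \<Rightarrow> real^'n) \<Rightarrow> real \<Rightarrow> ('w \<Rightarrow> real^'n) \<Rightarrow> bool"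
where
  "has_ito_integral P w i \<xi> t X \<longleftrightarrow>
     X \<in> borel_measurable (brownian_filtration P w t) \<and>
     (\<exists>K \<tau> \<phi>.
        (\<forall>k. simple_integrand P w t (K k) (\<tau> k) (\<phi> k)) \<and>
        (\<lambda>k. \<integral>\<^sup>+\<omega>. (\<integral>\<^sup>+s\<in>{0..t}.
            ennreal ((norm (simple_process (K k) (\<tau> k) (\<phi> k) s \<omega> - \<xi> s \<omega>))\<^sup>2) \<partial>lborel) \<partial>P)
          \<longlonglongrightarrow> 0 \<and>
        (\<lambda>k. \<integral>\<^sup>+\<omega>.
            ennreal ((norm (simple_ito_integral w i (K k) (\<tau> k) (\<phi> k) \<omega> - X \<omega>))\<^sup>2) \<partial>P)
          \<longlonglongrightarrow> 0)"


section \<open>The dual-observation system\<close>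

text \<open>
  An adapted mean-square continuous process is only determined up to modification, and an arbitrary
  modification may fail to be jointly measurable, in which case the pathwise \<open>ds\<close>-integral is
  meaningless. As usual \<open>y\<close> therefore denotes a progressively measurable version. The solution is
  unique up to modification of \<open>y\<close> and up to equality of \<open>Y\<close> almost everywhere in \<open>(t, \<omega>)\<close>.
\<close>

definition dual_solution ::
  "real^'n^'n \<Rightarrow> ('d \<Rightarrow> real^'n^'n) \<Rightarrow> 'w measure \<Rightarrow> (real \<Rightarrow> 'w \<Rightarrow> real^'d) \<Rightarrow> real \<Rightarrow>
   ('w \<Rightarrow> real^'n) \<Rightarrow> (real \<Rightarrow> 'w \<Rightarrow> real^'n) \<Rightarrow> ('d \<Rightarrow> real \<Rightarrow> 'w \<Rightarrow> real^'n) \<Rightarrow> bool"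
where
  "dual_solution A C P w T y1 y Y \<longleftrightarrow>
     y \<in> C_proc P w T \<and> progressive P w T y \<and> (\<forall>i. Y i \<in> L2_proc P w T) \<and>
     (AE \<omega> in P. y T \<omega> = y1 \<omega>) \<and>
     (\<forall>t\<in>{0..T}. \<exists>I. (\<forall>i. has_ito_integral P w i (Y i) t (I i)) \<and>
        (AE \<omega> in P. y t \<omega> = y 0 \<omega>
           + (LINT s:{0..t}|lborel.
                - (transpose A *v y s \<omega>) - (\<Sum>i\<in>UNIV. transpose (C i) *v Y i s \<omega>))
           + (\<Sum>i\<in>UNIV. I i \<omega>)))"

definition dual_output ::
  "real^'m^'n \<Rightarrow> ('d \<Rightarrow> real^'m^'n) \<Rightarrow> (real \<Rightarrow> 'w \<Rightarrow> real^'n) \<Rightarrow> ('d::finite \<Rightarrow> real \<Rightarrow> 'w \<Rightarrow> real^'n) \<Rightarrow>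
   real \<Rightarrow> 'w \<Rightarrow> real^'m"
where
  "dual_output B D y Y t \<omega> =
     transpose B *v y t \<omega> + (\<Sum>i\<in>UNIV. transpose (D i) *v Y i t \<omega>)"


section \<open>Observability\<close>

text \<open>
  The inequality is imposed on every solution with terminal value \<open>y1\<close>; the solution being unique
  up to versions, all of them give the same three expectations.
\<close>

definition observability_ineq ::
  "real^'n^'n \<Rightarrow> real^'m^'n \<Rightarrow> ('d \<Rightarrow> real^'n^'n) \<Rightarrow> ('d \<Rightarrow> real^'m^'n) \<Rightarrow>
   'w measure \<Rightarrow> (real \<Rightarrow> 'w \<Rightarrow> real^'d) \<Rightarrow> real \<Rightarrow> real \<Rightarrow> real \<Rightarrow> bool"
where
  "observability_ineq A B C D P w T \<delta> c \<longleftrightarrow>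
     (\<forall>y1\<in>L2_rv P w T. \<forall>y Y. dual_solution A C P w T y1 y Y \<longrightarrow>
        (\<integral>\<omega>. (norm (y 0 \<omega>))\<^sup>2 \<partial>P)
          \<le> c * (\<integral>\<omega>. (LINT t:{0..T}|lborel. (norm (dual_output B D y Y t \<omega>))\<^sup>2) \<partial>P)
            + \<delta> * (\<integral>\<omega>. (norm (y1 \<omega>))\<^sup>2 \<partial>P))"

definition delta_observable ::
  "real^'n^'n \<Rightarrow> real^'m^'n \<Rightarrow> ('d \<Rightarrow> real^'n^'n) \<Rightarrow> ('d \<Rightarrow> real^'m^'n) \<Rightarrow>
   'w measure \<Rightarrow> (real \<Rightarrow> 'w \<Rightarrow> real^'d) \<Rightarrow> real \<Rightarrow> real \<Rightarrow> bool"
where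
  "delta_observable A B C D P w T \<delta> \<longleftrightarrow> (\<exists>c>0. observability_ineq A B C D P w T \<delta> c)"

definition O_op ::
  "real^'n^'n \<Rightarrow> real^'m^'n \<Rightarrow> ('d \<Rightarrow> real^'n^'n) \<Rightarrow> ('d \<Rightarrow> real^'m^'n) \<Rightarrow>
   'w measure \<Rightarrow> (real \<Rightarrow> 'w \<Rightarrow> real^'d) \<Rightarrow> real \<Rightarrow> real \<Rightarrow> real"
where
  "O_op A B C D P w T \<delta> = Inf {c. 0 \<le> c \<and> observability_ineq A B C D P w T \<delta> c}"

end

theory Submission
  imports Defs
begin

text \<open>
  The inequality that defines observability only involves the joint law of a solution, its output
  and the Brownian motion. The proof makes this precise by carrying every solution over one
  Brownian basis \<open>(P, w)\<close> to a solution over any other basis \<open>(Q, v)\<close>, with the same three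
  expectations. An inequality that holds with constant \<open>c\<close> over \<open>(Q, v)\<close> then holds with the same
  \<open>c\<close> over \<open>(P, w)\<close>, and by symmetry the sets of admissible constants coincide. Both claims of the
  theorem follow at once.

  Two facts make the transport possible. The law of the trajectory \<open>(w s)\<close>, \<open>0 \<le> s \<le> t\<close>, on the
  product sigma-algebra is the same for all standard Brownian motions (\<open>trajectory_law_unique\<close>).
  And every random variable that is measurable for the augmented filtration at time \<open>t\<close> is almost
  surely a measurable function of this trajectory; for a jointly measurable process the null set
  can be chosen simultaneously for all times (\<open>product_measurable_representation\<close>). The counterpart
  over \<open>(Q, v)\<close> of a process \<open>\<xi> s \<omega> = g (s, trajectory w T \<omega>)\<close> should therefore be
  \<open>g (s, trajectory v T \<omega>)\<close>, and all integrals and almost sure identities agree.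

  The difficulty is that \<open>g (s, trajectory v T \<omega>)\<close> need not be progressively measurable, because \<open>g\<close>
  may look at the whole trajectory up to \<open>T\<close>. A progressive version is the pointwise limit of
  progressive approximations. For the integrands \<open>Y i\<close> these are the simple processes that define
  the Ito integral over \<open>{0..T}\<close>: their coefficients transport one by one, which also transports the
  Ito integrals themselves (\<open>has_ito_integral_transport\<close>, \<open>has_ito_integral_progressive_version\<close>).
  For \<open>y\<close>, which must be correct at every single time and not only at almost every time, they are
  the step processes on finer and finer time grids; they converge because \<open>y\<close> is uniformly
  continuous in mean square (\<open>mean_square_continuous_version\<close>). With these versions the equation
  at each time \<open>t\<close> is an almost sure identity between two functionals of the trajectory, so it
  passes from \<open>w\<close> to \<open>v\<close> (\<open>dual_solution_transport\<close>).
\<close>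

section \<open>Trajectories and the Brownian filtration\<close>

text \<open>
  Outside \<open>{0..t}\<close> the value is \<open>undefined\<close>, so that trajectories are points of the product space.
\<close>
definition trajectory :: "(real \<Rightarrow> 'w \<Rightarrow> 'b) \<Rightarrow> real \<Rightarrow> 'w \<Rightarrow> real \<Rightarrow> 'b" where
  "trajectory w t \<omega> = (\<lambda>s\<in>{0..t}. w s \<omega>)"

abbreviation path_space :: "real \<Rightarrow> (real \<Rightarrow> 'b::topological_space) measure" where
  "path_space t \<equiv> PiM {0..t} (\<lambda>_. borel)"

lemma restrict_trajectory: "s \<le> t \<Longrightarrow> restrict (trajectory w t \<omega>) {0..s} = trajectory w s \<omega>"
  by (auto simp: trajectory_def fun_eq_iff)

lemma measurable_trajectory_restrict:
  assumes "f \<in> measurable (path_space s) N" "s \<le> t"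
  shows "(\<lambda>x. f (restrict x {0..s})) \<in> measurable (path_space t) N"
  by (rule measurable_compose[OF measurable_restrict_subset assms(1)]) (use assms(2) in auto)

lemma bm_prob_space: "standard_brownian_motion P w \<Longrightarrow> prob_space P"
  by (simp add: standard_brownian_motion_def)

lemma bm_measurable: "standard_brownian_motion P w \<Longrightarrow> 0 \<le> t \<Longrightarrow> w t \<in> borel_measurable P"
  by (simp add: standard_brownian_motion_def)

lemma measurable_trajectory:
  assumes "standard_brownian_motion P w"
  shows "trajectory w t \<in> measurable P (path_space t)"
  unfolding trajectory_def by (rule measurable_restrict) (use assms bm_measurable in auto)

lemma space_natural_sigma [simp]: "space (natural_sigma P w t) = space P"
  by (simp add: natural_sigma_def space_measure_of_conv)

lemma space_brownian_filtration [simp]: "space (brownian_filtration P w t) = space P"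
  by (simp add: brownian_filtration_def space_measure_of_conv)

lemma sets_natural_sigma:
  "sets (natural_sigma P w t) =
     sigma_sets (space P) {w s -` A \<inter> space P | s A. s \<in> {0..t} \<and> A \<in> sets borel}"
  unfolding natural_sigma_def by (rule sets_measure_of) auto

lemma sets_brownian_filtration:
  "sets (brownian_filtration P w t) =
     sigma_sets (space P) (sets (natural_sigma P w t) \<union> null_sets P)"
  unfolding brownian_filtration_def
proof (rule sets_measure_of)
  show "sets (natural_sigma P w t) \<union> null_sets P \<subseteq> Pow (space P)"
    using sets.sets_into_space[of _ "natural_sigma P w t"] sets.sets_into_space[of _ P] by auto
qed

lemma measurable_natural_sigma:
  assumes "s \<in> {0..t}" shows "w s \<in> borel_measurable (natural_sigma P w t)"
  using assms by (intro measurableI) (auto simp: sets_natural_sigma)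

lemma natural_sigma_le_brownian:
  "sets (natural_sigma P w t) \<subseteq> sets (brownian_filtration P w t)"
  by (auto simp: sets_brownian_filtration)

lemma sets_brownian_filtration_mono:
  assumes "s \<le> t"
  shows "sets (brownian_filtration P w s) \<subseteq> sets (brownian_filtration P w t)"
proof -
  have "sets (natural_sigma P w s) \<subseteq> sets (natural_sigma P w t)"
    unfolding sets_natural_sigma using assms by (intro sigma_sets_mono') fastforce
  then show ?thesis
    unfolding sets_brownian_filtration by (intro sigma_sets_mono') auto
qed

lemma sets_brownian_filtration_subset:
  assumes "standard_brownian_motion P w"
  shows "sets (brownian_filtration P w t) \<subseteq> sets P"
proof -
  have "sets (natural_sigma P w t) \<subseteq> sets P"
    unfolding sets_natural_sigma
    using assms by (intro sets.sigma_sets_subset) (auto dest: bm_measurable intro!: measurable_sets)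
  then show ?thesis
    unfolding sets_brownian_filtration by (intro sets.sigma_sets_subset) auto
qed

lemma measurable_brownian_mono:
  assumes "s \<le> t" "f \<in> measurable (brownian_filtration P w s) N"
  shows "f \<in> measurable (brownian_filtration P w t) N"
  using measurable_mono[OF order_refl refl sets_brownian_filtration_mono[OF assms(1)]] assms(2)
  by auto

lemma measurable_from_brownian:
  assumes "standard_brownian_motion P w" "f \<in> measurable (brownian_filtration P w t) N"
  shows "f \<in> measurable P N"
  using measurable_mono[OF order_refl refl sets_brownian_filtration_subset[OF assms(1)]] assms(2)
  by auto

lemma measurable_trajectory_brownian:
  "trajectory w t \<in> measurable (brownian_filtration P w t) (path_space t)"
  unfolding trajectory_def
proof (rule measurable_restrict)
  fix s assume "s \<in> {0..t}"
  from measurable_natural_sigma[OF this]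
  show "w s \<in> borel_measurable (brownian_filtration P w t)"
    using measurable_mono[OF order_refl refl natural_sigma_le_brownian[of P w t]] by fastforce
qed

section \<open>The law of a Brownian trajectory\<close>

text \<open>
  The independence of the increment from the past, in the form in which it determines joint laws.
\<close>
lemma distr_pair_increment:
  assumes bm: "standard_brownian_motion P w" and st: "0 \<le> s" "s < t"
    and X: "X \<in> measurable (natural_sigma P w s) M"
  shows "distr P M X \<Otimes>\<^sub>M distr P borel (\<lambda>\<omega>. w t \<omega> - w s \<omega>) =
         distr P (M \<Otimes>\<^sub>M borel) (\<lambda>\<omega>. (X \<omega>, w t \<omega> - w s \<omega>))"
proof -
  interpret prob_space P using bm by (rule bm_prob_space)
  let ?D = "\<lambda>\<omega>. w t \<omega> - w s \<omega>"
  have ind: "indep_set (sets (natural_sigma P w s)) (sets (vimage_algebra (space P) ?D borel))"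
    using bm st by (simp add: standard_brownian_motion_def)
  have ws: "w t \<in> borel_measurable P" "w s \<in> borel_measurable P"
    using bm st by (auto intro: bm_measurable)
  have D[measurable]: "?D \<in> borel_measurable P" by (rule borel_measurable_diff[OF ws])
  have sub: "sets (natural_sigma P w s) \<subseteq> sets P"
    using natural_sigma_le_brownian sets_brownian_filtration_subset[OF bm] by blast
  have XP[measurable]: "X \<in> measurable P M"
    using measurable_mono[OF order_refl refl sub] X by auto
  interpret X: prob_space "distr P M X" by (rule prob_space_distr) fact
  interpret D: prob_space "distr P borel ?D" by (rule prob_space_distr) fact
  show ?thesis
  proof (rule pair_measure_eqI)
    fix A B assume "A \<in> sets (distr P M X)" "B \<in> sets (distr P borel ?D)"
    then have A[measurable]: "A \<in> sets M" and B[measurable]: "B \<in> sets borel" by auto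
    have "X -` A \<inter> space P \<in> sets (natural_sigma P w s)"
      using measurable_sets[OF X A] by simp
    moreover have "?D -` B \<inter> space P \<in> sets (vimage_algebra (space P) ?D borel)"
      by (rule in_vimage_algebra[OF B])
    ultimately have "prob ((X -` A \<inter> space P) \<inter> (?D -` B \<inter> space P)) =
        prob (X -` A \<inter> space P) * prob (?D -` B \<inter> space P)"
      by (rule indep_setD[OF ind])
    moreover have "(X -` A \<inter> space P) \<inter> (?D -` B \<inter> space P) =
        (\<lambda>\<omega>. (X \<omega>, ?D \<omega>)) -` (A \<times> B) \<inter> space P" by auto
    ultimately have "emeasure P ((\<lambda>\<omega>. (X \<omega>, ?D \<omega>)) -` (A \<times> B) \<inter> space P) =
        emeasure P (X -` A \<inter> space P) * emeasure P (?D -` B \<inter> space P)"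
      by (simp add: emeasure_eq_measure ennreal_mult')
    then show "emeasure (distr P M X) A * emeasure (distr P borel ?D) B =
        emeasure (distr P (M \<Otimes>\<^sub>M borel) (\<lambda>\<omega>. (X \<omega>, ?D \<omega>))) (A \<times> B)"
      by (subst (1 2 3) emeasure_distr) auto
  qed (auto intro: X.sigma_finite_measure_axioms D.sigma_finite_measure_axioms intro!: sets_pair_measure_cong)
qed

text \<open>
  The finite-dimensional distributions are determined by adding the times in increasing order: the
  newest value is the previous one plus an independent increment whose law is prescribed. Time \<open>0\<close>
  belongs to every index set, so that there always is a previous value.
\<close>
lemma fdd_eq:
  fixes w :: "real \<Rightarrow> 'a \<Rightarrow> real^'d" and v :: "real \<Rightarrow> 'b \<Rightarrow> real^'d"
  assumes w: "standard_brownian_motion P w" and v: "standard_brownian_motion Q v"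
    and U: "finite U" "U \<subseteq> {0<..}"
  shows "distr P (PiM (insert 0 U) (\<lambda>_. borel)) (\<lambda>\<omega>. \<lambda>s\<in>insert 0 U. w s \<omega>) =
         distr Q (PiM (insert 0 U) (\<lambda>_. borel)) (\<lambda>\<omega>. \<lambda>s\<in>insert 0 U. v s \<omega>)"
  using U
proof (induction U rule: finite_linorder_max_induct)
  case empty
  have "distr P (PiM {0} (\<lambda>_. borel)) (\<lambda>\<omega>. \<lambda>s\<in>{0}. w s \<omega>) =
      return (PiM {0} (\<lambda>_. borel)) (\<lambda>s\<in>{0}. 0)" (is "?L = _")
    if w: "standard_brownian_motion P w" for P :: "'c measure" and w :: "real \<Rightarrow> 'c \<Rightarrow> real^'d"
  proof -
    interpret prob_space P using w by (rule bm_prob_space)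
    have m: "(\<lambda>\<omega>. \<lambda>s\<in>{0}. w s \<omega>) \<in> measurable P (PiM {0} (\<lambda>_. borel))"
      by (rule measurable_restrict) (use w bm_measurable in auto)
    have "?L = distr P (PiM {0} (\<lambda>_. borel)) (\<lambda>\<omega>. \<lambda>s\<in>{0}. 0)"
    proof (rule distr_cong_AE)
      show "AE \<omega> in P. (\<lambda>s\<in>{0}. w s \<omega>) = (\<lambda>s\<in>{0}. 0)"
        using w unfolding standard_brownian_motion_def
        by (auto elim!: eventually_mono simp: restrict_def fun_eq_iff)
    qed (use m in auto)
    also have "\<dots> = return (PiM {0} (\<lambda>_. borel)) (\<lambda>s\<in>{0}. 0)"
      by (rule distr_const) (auto simp: space_PiM)
    finally show ?thesis .
  qed
  from this[OF w] this[OF v] show ?case by (simp only:)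
next
  case (insert b U)
  define J where "J = insert 0 U"
  define s where "s = Max J"
  have J: "finite J" "J \<noteq> {}" using insert by (auto simp: J_def)
  have sJ: "s \<in> J" and sM: "\<And>r. r \<in> J \<Longrightarrow> r \<le> s" using J by (auto simp: s_def)
  have J0: "\<And>r. r \<in> J \<Longrightarrow> 0 \<le> r" using insert by (auto simp: J_def less_imp_le)
  have sb: "0 \<le> s" "s < b" using insert sJ J0 by (auto simp: J_def)
  have bJ: "b \<notin> J" using sM sb by force
  have eq: "insert 0 (insert b U) = insert b J" by (auto simp: J_def)
  let ?M = "PiM J (\<lambda>_. borel :: (real^'d) measure)"
  define \<Phi> :: "(real \<Rightarrow> real^'d) \<times> (real^'d) \<Rightarrow> real \<Rightarrow> real^'d"
    where "\<Phi> = (\<lambda>p. \<lambda>r\<in>insert b J. if r = b then fst p s + snd p else fst p r)"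
  have \<Phi>[measurable]: "\<Phi> \<in> measurable (?M \<Otimes>\<^sub>M borel) (PiM (insert b J) (\<lambda>_. borel))"
    unfolding \<Phi>_def
  proof (rule measurable_restrict)
    fix r assume "r \<in> insert b J"
    then have "r \<noteq> b \<Longrightarrow> (\<lambda>p. fst p r) \<in> borel_measurable (?M \<Otimes>\<^sub>M borel)" 
      by (intro measurable_compose[OF measurable_fst]) (auto intro: measurable_component_singleton)
    moreover have "(\<lambda>p. fst p s) \<in> borel_measurable (?M \<Otimes>\<^sub>M borel)" 
      by (rule measurable_compose[OF measurable_fst]) (rule measurable_component_singleton[OF sJ])
    ultimately show "(\<lambda>p. if r = b then fst p s + snd p else fst p r)
         \<in> borel_measurable (?M \<Otimes>\<^sub>M borel)"
      by (cases "r = b") (auto intro!: borel_measurable_add)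
  qed
  have *: "distr P (PiM (insert b J) (\<lambda>_. borel)) (\<lambda>\<omega>. \<lambda>s\<in>insert b J. w s \<omega>) =
      distr (distr P ?M (\<lambda>\<omega>. \<lambda>s\<in>J. w s \<omega>) \<Otimes>\<^sub>M
        density lborel (\<lambda>x. ennreal (\<Prod>i\<in>UNIV. normal_density 0 (sqrt (b - s)) (x $ i))))
       (PiM (insert b J) (\<lambda>_. borel)) \<Phi>"
    if w: "standard_brownian_motion P w" for P :: "'c measure" and w :: "real \<Rightarrow> 'c \<Rightarrow> real^'d"
  proof -
    interpret prob_space P using w by (rule bm_prob_space)
    let ?X = "\<lambda>\<omega>. \<lambda>s\<in>J. w s \<omega>" and ?D = "\<lambda>\<omega>. w b \<omega> - w s \<omega>"
    have "?X \<in> measurable (natural_sigma P w s) ?M"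
      by (rule measurable_restrict) (use J0 sM in \<open>auto intro: measurable_natural_sigma\<close>)
    note ind = distr_pair_increment[OF w sb this]
    have X: "?X \<in> measurable P ?M"
      by (rule measurable_restrict) (use J0 w bm_measurable in auto)
    have D: "?D \<in> borel_measurable P"
      using w sb by (intro borel_measurable_diff bm_measurable) auto
    have "distr P (PiM (insert b J) (\<lambda>_. borel)) (\<lambda>\<omega>. \<lambda>s\<in>insert b J. w s \<omega>) =
       distr P (PiM (insert b J) (\<lambda>_. borel)) (\<Phi> \<circ> (\<lambda>x. (?X x, ?D x)))"
      using bJ sJ by (intro distr_cong) (auto simp: \<Phi>_def fun_eq_iff restrict_def)
    also have "\<dots> = distr (distr P (?M \<Otimes>\<^sub>M borel) (\<lambda>x. (?X x, ?D x))) (PiM (insert b J) (\<lambda>_. borel)) \<Phi>"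
      by (rule distr_distr[symmetric, OF \<Phi>]) (rule measurable_Pair[OF X D])
    also have "distr P (?M \<Otimes>\<^sub>M borel) (\<lambda>x. (?X x, ?D x)) = distr P ?M ?X \<Otimes>\<^sub>M distr P borel ?D"
      using ind ..
    also have "distr P borel ?D = distr P lborel ?D" by (rule distr_cong) auto
    also have "\<dots> =
        density lborel (\<lambda>x. ennreal (\<Prod>i\<in>UNIV. normal_density 0 (sqrt (b - s)) (x $ i)))"
      using w sb unfolding standard_brownian_motion_def distributed_def by blast
    finally show ?thesis .
  qed
  have "distr P ?M (\<lambda>\<omega>. \<lambda>s\<in>J. w s \<omega>) = distr Q ?M (\<lambda>\<omega>. \<lambda>s\<in>J. v s \<omega>)"
    unfolding J_def by (rule insert.IH) (use insert.prems in auto)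
  then show ?case unfolding eq *[OF w] *[OF v] by simp
qed

text \<open>
  The cylinder sets form a generator that is closed under intersections, so the finite-dimensional
  distributions determine the law.
\<close>
lemma trajectory_law_unique:
  fixes w :: "real \<Rightarrow> 'a \<Rightarrow> real^'d" and v :: "real \<Rightarrow> 'b \<Rightarrow> real^'d"
  assumes w: "standard_brownian_motion P w" and v: "standard_brownian_motion Q v"
  shows "distr P (path_space t) (trajectory w t) = distr Q (path_space t) (trajectory v t)"
proof (rule measure_eqI_PiM_infinite)
  show "finite_measure (distr P (path_space t) (trajectory w t))"
    using measurable_trajectory[OF w] bm_prob_space[OF w]
    by (intro prob_space.finite_measure prob_space.prob_space_distr)
  fix A :: "real \<Rightarrow> (real^'d) set" and J :: "real set"
  assume J: "finite J" "J \<subseteq> {0..t}" and A: "\<And>i. i \<in> J \<Longrightarrow> A i \<in> sets borel"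
  define U where "U = J - {0}"
  have U: "finite U" "U \<subseteq> {0<..}" using J by (auto simp: U_def)
  let ?A = "\<lambda>i. if i \<in> J then A i else UNIV"
  let ?J = "insert 0 U"
  have JU: "J \<subseteq> ?J" by (auto simp: U_def)
  have C: "Pi\<^sub>E ?J ?A \<in> sets (PiM ?J (\<lambda>_. borel))"
    using U A by (intro sets_PiM_I_finite) auto
  have *: "emeasure (distr P (path_space t) (trajectory w t)) (prod_emb {0..t} (\<lambda>_. borel) J (Pi\<^sub>E J A)) =
     emeasure (distr P (PiM ?J (\<lambda>_. borel)) (\<lambda>\<omega>. \<lambda>s\<in>?J. w s \<omega>)) (Pi\<^sub>E ?J ?A)"
    if w: "standard_brownian_motion P w" for P :: "'c measure" and w :: "real \<Rightarrow> 'c \<Rightarrow> real^'d"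
  proof -
    have "(\<lambda>\<omega>. \<lambda>s\<in>?J. w s \<omega>) \<in> measurable P (PiM ?J (\<lambda>_. borel))"
      by (rule measurable_restrict) (use w bm_measurable U in \<open>force simp: less_imp_le\<close>)
    moreover have "trajectory w t -` prod_emb {0..t} (\<lambda>_. borel) J (Pi\<^sub>E J A) \<inter> space P =
        (\<lambda>\<omega>. \<lambda>s\<in>?J. w s \<omega>) -` Pi\<^sub>E ?J ?A \<inter> space P" (is "?l = ?r")
    proof -
      have "trajectory w t \<omega> \<in> prod_emb {0..t} (\<lambda>_. borel) J (Pi\<^sub>E J A) \<longleftrightarrow> (\<forall>s\<in>J. w s \<omega> \<in> A s)" for \<omega>
        using J by (auto simp: prod_emb_def trajectory_def PiE_iff restrict_def extensional_def subset_eq)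
      moreover have "(\<lambda>s\<in>?J. w s \<omega>) \<in> Pi\<^sub>E ?J ?A \<longleftrightarrow> (\<forall>s\<in>J. w s \<omega> \<in> A s)" for \<omega>
        using JU by (auto simp: PiE_iff)
      ultimately show ?thesis by auto
    qed
    ultimately show ?thesis
      by (subst (1 2) emeasure_distr)
         (use measurable_trajectory[OF w] C J A in \<open>auto intro!: sets_PiM_I\<close>)
  qed
  show "emeasure (distr P (path_space t) (trajectory w t)) (prod_emb {0..t} (\<lambda>_. borel) J (Pi\<^sub>E J A)) =
     emeasure (distr Q (path_space t) (trajectory v t)) (prod_emb {0..t} (\<lambda>_. borel) J (Pi\<^sub>E J A))"
    unfolding *[OF w] *[OF v] fdd_eq[OF w v U] ..
qed auto

section \<open>Random variables as functionals of the trajectory\<close>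

text \<open>
  The natural sigma-algebra is the one generated by the trajectory as a map into the path space.
\<close>
lemma natural_sigma_set_representation:
  fixes w :: "real \<Rightarrow> 'w \<Rightarrow> real^'d"
  assumes "B \<in> sets (natural_sigma P w t)"
  shows "\<exists>C\<in>sets (path_space t). \<forall>\<omega>\<in>space P. \<omega> \<in> B \<longleftrightarrow> trajectory w t \<omega> \<in> C"
proof -
  let ?V = "vimage_algebra (space P) (trajectory w t) (path_space t)"
  have "{w s -` A \<inter> space P | s A. s \<in> {0..t} \<and> A \<in> sets borel} \<subseteq> sets ?V"
  proof safe
    fix s and A :: "(real^'d) set" assume s: "s \<in> {0..t}" and A: "A \<in> sets borel"
    have "(\<lambda>x. x s) -` A \<inter> space (path_space t) \<in> sets (path_space t)"
      by (rule measurable_sets[OF measurable_component_singleton[OF s] A])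
    from in_vimage_algebra[OF this]
    have "trajectory w t -` ((\<lambda>x. x s) -` A \<inter> space (path_space t)) \<inter> space P \<in> sets ?V" .
    moreover have "trajectory w t -` ((\<lambda>x. x s) -` A \<inter> space (path_space t)) \<inter> space P =
        w s -` A \<inter> space P"
      using s by (auto simp: trajectory_def space_PiM)
    ultimately show "w s -` A \<inter> space P \<in> sets ?V" by simp
  qed
  from sets.sigma_sets_subset[OF this] have "B \<in> sets ?V"
    using assms by (auto simp: sets_natural_sigma)
  moreover have "trajectory w t \<in> space P \<rightarrow> space (path_space t)"
    by (auto simp: trajectory_def space_PiM)
  ultimately show ?thesis by (auto simp: sets_vimage_algebra2)
qed

lemma brownian_filtration_set_representation:
  assumes "B \<in> sets (brownian_filtration P w t)"
  shows "\<exists>C\<in>sets (path_space t). AE \<omega> in P. \<omega> \<in> B \<longleftrightarrow> trajectory w t \<omega> \<in> C"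
  using assms unfolding sets_brownian_filtration
proof (induction rule: sigma_sets.induct)
  case (Basic B)
  then show ?case
  proof
    assume "B \<in> sets (natural_sigma P w t)"
    from natural_sigma_set_representation[OF this]
    obtain C where "C \<in> sets (path_space t)" "\<forall>\<omega>\<in>space P. \<omega> \<in> B \<longleftrightarrow> trajectory w t \<omega> \<in> C"
      by blast
    then show ?thesis by (intro bexI[of _ C] AE_I2) simp_all
  next
    assume "B \<in> null_sets P"
    then have "AE \<omega> in P. \<omega> \<in> B \<longleftrightarrow> trajectory w t \<omega> \<in> {}" by (auto dest: AE_not_in)
    then show ?thesis by (intro bexI[of _ "{}"]) simp_all
  qed
next
  case Empty
  have "AE \<omega> in P. \<omega> \<in> {} \<longleftrightarrow> trajectory w t \<omega> \<in> {}" by simp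
  then show ?case by blast
next
  case (Compl B)
  then obtain C where C: "C \<in> sets (path_space t)" "AE \<omega> in P. \<omega> \<in> B \<longleftrightarrow> trajectory w t \<omega> \<in> C"
    by blast
  have "AE \<omega> in P. \<omega> \<in> space P - B \<longleftrightarrow> trajectory w t \<omega> \<in> space (path_space t) - C"
    using C(2) AE_space by eventually_elim (auto simp: trajectory_def space_PiM)
  then show ?case using C(1) by blast
next
  case (Union B)
  then have "\<forall>i. \<exists>C. C \<in> sets (path_space t) \<and> (AE \<omega> in P. \<omega> \<in> B i \<longleftrightarrow> trajectory w t \<omega> \<in> C)"
    by blast
  from choice[OF this] obtain C where C: "\<And>i. C i \<in> sets (path_space t)"
    "\<And>i. AE \<omega> in P. \<omega> \<in> B i \<longleftrightarrow> trajectory w t \<omega> \<in> C i" by auto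
  have "AE \<omega> in P. \<forall>i::nat. \<omega> \<in> B i \<longleftrightarrow> trajectory w t \<omega> \<in> C i"
    using C(2) by (simp add: AE_all_countable)
  then have "AE \<omega> in P. \<omega> \<in> (\<Union>i. B i) \<longleftrightarrow> trajectory w t \<omega> \<in> (\<Union>i. C i)" by eventually_elim auto
  moreover have "(\<Union>i. C i) \<in> sets (path_space t)" using C(1) by auto
  ultimately show ?case by blast
qed

text \<open>
  The exceptional null set does not depend on the parameter \<open>s\<close>: only countably many rectangles
  enter the construction of a set of the product sigma-algebra.
\<close>
lemma product_set_representation:
  assumes "A \<in> sets (M \<Otimes>\<^sub>M brownian_filtration P w t)"
  shows "\<exists>C\<in>sets (M \<Otimes>\<^sub>M path_space t).
           AE \<omega> in P. \<forall>s\<in>space M. (s, \<omega>) \<in> A \<longleftrightarrow> (s, trajectory w t \<omega>) \<in> C"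
  using assms unfolding sets_pair_measure[of M "brownian_filtration P w t"]
proof (induction rule: sigma_sets.induct)
  case (Basic A)
  then obtain a b where A: "A = a \<times> b" "a \<in> sets M" "b \<in> sets (brownian_filtration P w t)"
    by blast
  then obtain C where C: "C \<in> sets (path_space t)" "AE \<omega> in P. \<omega> \<in> b \<longleftrightarrow> trajectory w t \<omega> \<in> C"
    using brownian_filtration_set_representation by blast
  have "AE \<omega> in P. \<forall>s\<in>space M. (s, \<omega>) \<in> A \<longleftrightarrow> (s, trajectory w t \<omega>) \<in> a \<times> C"
    using C(2) by eventually_elim (auto simp: A)
  moreover have "a \<times> C \<in> sets (M \<Otimes>\<^sub>M path_space t)" using A C by auto
  ultimately show ?case by blast
next
  case Empty
  have "AE \<omega> in P. \<forall>s\<in>space M. (s, \<omega>) \<in> {} \<longleftrightarrow> (s, trajectory w t \<omega>) \<in> {}" by simp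
  then show ?case by blast
next
  case (Compl A)
  then obtain C where C: "C \<in> sets (M \<Otimes>\<^sub>M path_space t)"
    "AE \<omega> in P. \<forall>s\<in>space M. (s, \<omega>) \<in> A \<longleftrightarrow> (s, trajectory w t \<omega>) \<in> C"
    by blast
  have "AE \<omega> in P. \<forall>s\<in>space M. (s, \<omega>) \<in> space M \<times> space (brownian_filtration P w t) - A \<longleftrightarrow>
      (s, trajectory w t \<omega>) \<in> space (M \<Otimes>\<^sub>M path_space t) - C"
    using C(2) AE_space
    by eventually_elim (auto simp: trajectory_def space_PiM space_pair_measure)
  then show ?case using C(1) by blast
next
  case (Union A)
  then have "\<forall>i. \<exists>C. C \<in> sets (M \<Otimes>\<^sub>M path_space t) \<and>
    (AE \<omega> in P. \<forall>s\<in>space M. (s, \<omega>) \<in> A i \<longleftrightarrow> (s, trajectory w t \<omega>) \<in> C)"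
    by blast
  from choice[OF this] obtain C where C: "\<And>i. C i \<in> sets (M \<Otimes>\<^sub>M path_space t)"
    "\<And>i. AE \<omega> in P. \<forall>s\<in>space M. (s, \<omega>) \<in> A i \<longleftrightarrow> (s, trajectory w t \<omega>) \<in> C i" by auto
  have "AE \<omega> in P. \<forall>i::nat. \<forall>s\<in>space M. (s, \<omega>) \<in> A i \<longleftrightarrow> (s, trajectory w t \<omega>) \<in> C i"
    using C(2) by (simp add: AE_all_countable)
  then have "AE \<omega> in P. \<forall>s\<in>space M. (s, \<omega>) \<in> (\<Union>i. A i) \<longleftrightarrow> (s, trajectory w t \<omega>) \<in> (\<Union>i. C i)"
    by eventually_elim auto
  moreover have "(\<Union>i. C i) \<in> sets (M \<Otimes>\<^sub>M path_space t)" using C(1) by auto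
  ultimately show ?case by blast
qed

text \<open>
  A Doob-Dynkin factorisation with a parameter. Approximate \<open>f\<close> by simple functions, represent
  their finitely many level sets, and take the limit of the resulting functionals.
\<close>
lemma product_measurable_representation:
  fixes f :: "'s \<times> 'w \<Rightarrow> 'b::{banach, second_countable_topology}"
  assumes f: "f \<in> borel_measurable (M \<Otimes>\<^sub>M brownian_filtration P w t)"
  obtains g where "g \<in> borel_measurable (M \<Otimes>\<^sub>M path_space t)"
    "AE \<omega> in P. \<forall>s\<in>space M. f (s, \<omega>) = g (s, trajectory w t \<omega>)"
proof -
  let ?N = "M \<Otimes>\<^sub>M brownian_filtration P w t"
  from borel_measurable_implies_sequence_metric[OF f, of 0]
  obtain F where F: "\<And>i. simple_function ?N (F i)"
    and lim: "\<And>x. x \<in> space ?N \<Longrightarrow> (\<lambda>i. F i x) \<longlonglongrightarrow> f x"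
    by blast
  let ?R = "\<lambda>i. F i ` space ?N"
  have "\<forall>z. \<exists>C. C \<in> sets (M \<Otimes>\<^sub>M path_space t) \<and> (AE \<omega> in P. \<forall>s\<in>space M.
      (s, \<omega>) \<in> F (fst z) -` {snd z} \<inter> space ?N \<longleftrightarrow> (s, trajectory w t \<omega>) \<in> C)"
    using product_set_representation[OF simple_functionD(2)[OF F]] unfolding Bex_def by (rule allI)
  from choice[OF this] obtain C' where C': "\<forall>z. C' z \<in> sets (M \<Otimes>\<^sub>M path_space t) \<and>
    (AE \<omega> in P. \<forall>s\<in>space M.
      (s, \<omega>) \<in> F (fst z) -` {snd z} \<inter> space ?N \<longleftrightarrow> (s, trajectory w t \<omega>) \<in> C' z)"
    ..
  define C where "C i c = C' (i, c)" for i c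
  have C[measurable]: "C i c \<in> sets (M \<Otimes>\<^sub>M path_space t)" for i c
    using C'[rule_format, of "(i, c)"] by (simp add: C_def)
  have eq: "AE \<omega> in P. \<forall>s\<in>space M.
      (s, \<omega>) \<in> F i -` {c} \<inter> space ?N \<longleftrightarrow> (s, trajectory w t \<omega>) \<in> C i c" for i c
    using C'[rule_format, of "(i, c)"] by (simp add: C_def)
  define G where "G i z = (\<Sum>c\<in>?R i. indicator (C i c) z *\<^sub>R c)" for i z
  have fin: "finite (?R i)" for i using simple_functionD(1)[OF F] .
  have G: "G i \<in> borel_measurable (M \<Otimes>\<^sub>M path_space t)" for i
    unfolding G_def by measurable
  have "AE \<omega> in P. \<forall>i. \<forall>c\<in>?R i. \<forall>s\<in>space M.
      (s, \<omega>) \<in> F i -` {c} \<inter> space ?N \<longleftrightarrow> (s, trajectory w t \<omega>) \<in> C i c"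
    unfolding AE_all_countable by (rule allI, rule AE_finite_allI, rule fin, rule eq)
  then have "AE \<omega> in P. \<forall>s\<in>space M. f (s, \<omega>) = lim (\<lambda>i. G i (s, trajectory w t \<omega>))"
    using AE_space
  proof eventually_elim
    case (elim \<omega>)
    show ?case
    proof
      fix s assume s: "s \<in> space M"
      then have sp: "(s, \<omega>) \<in> space ?N" using elim by (simp add: space_pair_measure)
      have "G i (s, trajectory w t \<omega>) = F i (s, \<omega>)" for i
      proof -
        have "G i (s, trajectory w t \<omega>) = (\<Sum>c\<in>?R i. if c = F i (s, \<omega>) then c else 0)"
          unfolding G_def
        proof (rule sum.cong[OF refl])
          fix c assume "c \<in> ?R i"
          then have "(s, \<omega>) \<in> F i -` {c} \<inter> space ?N \<longleftrightarrow> (s, trajectory w t \<omega>) \<in> C i c"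
            using elim(1) s by blast
          then show "indicator (C i c) (s, trajectory w t \<omega>) *\<^sub>R c =
              (if c = F i (s, \<omega>) then c else 0)"
            using sp by (auto simp: indicator_def)
        qed
        also have "\<dots> = F i (s, \<omega>)" using fin[of i] sp by simp
        finally show ?thesis .
      qed
      then show "f (s, \<omega>) = lim (\<lambda>i. G i (s, trajectory w t \<omega>))"
        using limI[OF lim[OF sp]] by simp
    qed
  qed
  moreover have "(\<lambda>z. lim (\<lambda>i. G i z)) \<in> borel_measurable (M \<Otimes>\<^sub>M path_space t)"
    using G by (rule borel_measurable_lim_metric)
  ultimately show ?thesis using that by blast
qed

lemma measurable_representation:
  fixes X :: "'w \<Rightarrow> 'b::{banach, second_countable_topology}"
  assumes X: "X \<in> borel_measurable (brownian_filtration P w t)"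
  obtains f where "f \<in> borel_measurable (path_space t)"
    "AE \<omega> in P. X \<omega> = f (trajectory w t \<omega>)"
proof -
  have "(\<lambda>p. X (snd p)) \<in> borel_measurable (count_space {()} \<Otimes>\<^sub>M brownian_filtration P w t)"
    by (rule measurable_compose[OF measurable_snd X])
  from product_measurable_representation[OF this] obtain g
    where g: "g \<in> borel_measurable (count_space {()} \<Otimes>\<^sub>M path_space t)"
      "AE \<omega> in P. X \<omega> = g ((), trajectory w t \<omega>)" by auto
  have "(\<lambda>x. g ((), x)) \<in> borel_measurable (path_space t)"
    by (rule measurable_compose[OF measurable_Pair1' g(1)]) simp
  with g(2) show ?thesis using that by blast
qed

text \<open>
  Processes carry information only on \<open>{0..T}\<close>. Precomposing with the retraction onto this interval
  gives a process on the whole real line, whose joint measurability can be stated with the same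
  time measure \<^const>\<open>lborel\<close> for every \<open>T\<close>.
\<close>
definition clamp_time :: "real \<Rightarrow> real \<Rightarrow> real" where
  "clamp_time T s = max 0 (min T s)"

lemma clamp_time_id: "s \<in> {0..T} \<Longrightarrow> clamp_time T s = s"
  by (simp add: clamp_time_def)

lemma progressive_jointly_measurable:
  assumes \<xi>: "progressive P w T \<xi>" and T: "0 \<le> T"
  shows "(\<lambda>p. \<xi> (clamp_time T (fst p)) (snd p)) \<in> borel_measurable (borel \<Otimes>\<^sub>M brownian_filtration P w T)"
proof -
  have "clamp_time T \<in> measurable borel (restrict_space borel {0..T})"
    using T unfolding clamp_time_def by (intro measurable_restrict_space2) (auto, measurable)
  then have "(\<lambda>p. (clamp_time T (fst p), snd p)) \<in> measurable (borel \<Otimes>\<^sub>M brownian_filtration P w T)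
      (restrict_space borel {0..T} \<Otimes>\<^sub>M brownian_filtration P w T)"
    by (intro measurable_Pair measurable_snd measurable_compose[OF measurable_fst])
  from measurable_compose[OF this, of "\<lambda>(s, \<omega>). \<xi> s \<omega>"] show ?thesis
    using \<xi> T by (simp add: progressive_def)
qed

lemma progressive_representation:
  fixes \<xi> :: "real \<Rightarrow> 'w \<Rightarrow> real^'n"
  assumes "progressive P w T \<xi>" and "0 \<le> T"
  obtains g where "g \<in> borel_measurable (borel \<Otimes>\<^sub>M path_space T)"
    "AE \<omega> in P. \<forall>s\<in>{0..T}. \<xi> s \<omega> = g (s, trajectory w T \<omega>)"
proof -
  from product_measurable_representation[OF progressive_jointly_measurable[OF assms]]
  obtain g where g: "g \<in> borel_measurable (borel \<Otimes>\<^sub>M path_space T)"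
    "AE \<omega> in P. \<forall>s. \<xi> (clamp_time T s) \<omega> = g (s, trajectory w T \<omega>)" by auto
  from g(2) have "AE \<omega> in P. \<forall>s\<in>{0..T}. \<xi> s \<omega> = g (s, trajectory w T \<omega>)"
    by eventually_elim (metis clamp_time_id)
  with g(1) show ?thesis using that by blast
qed

lemma progressive_adapted:
  assumes \<xi>: "progressive P w T \<xi>" and t: "t \<in> {0..T}"
  shows "\<xi> t \<in> borel_measurable (brownian_filtration P w t)"
proof -
  have "(\<lambda>\<omega>. (t, \<omega>)) \<in> measurable (brownian_filtration P w t)
      (restrict_space borel {0..t} \<Otimes>\<^sub>M brownian_filtration P w t)"
    using t by (intro measurable_Pair1') (auto simp: space_restrict_space)
  from measurable_compose[OF this \<xi>[unfolded progressive_def, rule_format, OF t]] show ?thesis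
    by simp
qed

lemma progressive_lim:
  fixes Z :: "nat \<Rightarrow> real \<Rightarrow> 'w \<Rightarrow> real^'n"
  assumes "\<And>k. progressive P w T (Z k)"
  shows "progressive P w T (\<lambda>s \<omega>. lim (\<lambda>k. Z k s \<omega>))"
  unfolding progressive_def
proof
  fix t assume "t \<in> {0..T}"
  then have "(\<lambda>p. Z k (fst p) (snd p))
      \<in> borel_measurable (restrict_space borel {0..t} \<Otimes>\<^sub>M brownian_filtration P w t)" for k
    using assms[of k] by (auto simp: progressive_def split_beta')
  then show "(\<lambda>(s, \<omega>). lim (\<lambda>k. Z k s \<omega>))
      \<in> borel_measurable (restrict_space borel {0..t} \<Otimes>\<^sub>M brownian_filtration P w t)"
    unfolding split_beta' by (rule borel_measurable_lim_metric)
qed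

section \<open>Equality of expectations and almost sure identities\<close>

locale brownian_pair =
  fixes P :: "'a measure" and w :: "real \<Rightarrow> 'a \<Rightarrow> real^'d"
    and Q :: "'b measure" and v :: "real \<Rightarrow> 'b \<Rightarrow> real^'d"
  assumes bmP: "standard_brownian_motion P w" and bmQ: "standard_brownian_motion Q v"
begin

sublocale P: prob_space P using bmP by (rule bm_prob_space)
sublocale Q: prob_space Q using bmQ by (rule bm_prob_space)

lemmas measurable_trajectoryP [measurable] = measurable_trajectory[OF bmP]
lemmas measurable_trajectoryQ [measurable] = measurable_trajectory[OF bmQ]

lemma nn_integral_transport:
  assumes "F \<in> borel_measurable (path_space t)"
  shows "(\<integral>\<^sup>+\<omega>. F (trajectory w t \<omega>) \<partial>P) = (\<integral>\<^sup>+\<omega>. F (trajectory v t \<omega>) \<partial>Q)"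
  using nn_integral_distr[OF measurable_trajectoryP, of F t] nn_integral_distr[OF measurable_trajectoryQ, of F t]
    assms trajectory_law_unique[OF bmP bmQ, of t] by simp

lemma integral_transport:
  fixes F :: "_ \<Rightarrow> 'c::{banach, second_countable_topology}"
  assumes "F \<in> borel_measurable (path_space t)"
  shows "(\<integral>\<omega>. F (trajectory w t \<omega>) \<partial>P) = (\<integral>\<omega>. F (trajectory v t \<omega>) \<partial>Q)"
  using integral_distr[OF measurable_trajectoryP, of F t] integral_distr[OF measurable_trajectoryQ, of F t]
    assms trajectory_law_unique[OF bmP bmQ, of t] by simp

lemma integrable_transport:
  fixes F :: "_ \<Rightarrow> 'c::{banach, second_countable_topology}"
  assumes "F \<in> borel_measurable (path_space t)"
  shows "integrable P (\<lambda>\<omega>. F (trajectory w t \<omega>)) \<longleftrightarrow> integrable Q (\<lambda>\<omega>. F (trajectory v t \<omega>))"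
  using integrable_distr_eq[OF measurable_trajectoryP, of F t] integrable_distr_eq[OF measurable_trajectoryQ, of F t]
    assms trajectory_law_unique[OF bmP bmQ, of t] by simp

lemma AE_eq_transport:
  fixes F G :: "_ \<Rightarrow> 'c::{second_countable_topology, t2_space}"
  assumes [measurable]: "F \<in> borel_measurable (path_space t)" "G \<in> borel_measurable (path_space t)"
  assumes AE: "AE \<omega> in P. F (trajectory w t \<omega>) = G (trajectory w t \<omega>)"
  shows "AE \<omega> in Q. F (trajectory v t \<omega>) = G (trajectory v t \<omega>)"
proof -
  have m: "{x\<in>space (path_space t). F x = G x} \<in> sets (path_space t)" by measurable
  show ?thesis
    using AE unfolding AE_distr_iff[OF measurable_trajectoryP m, symmetric]
      AE_distr_iff[OF measurable_trajectoryQ m, symmetric] trajectory_law_unique[OF bmP bmQ, of t] .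
qed

end

section \<open>Transport of Ito integrals\<close>

text \<open>
  The sum of all \<open>f j\<close> has finite integral, so it is finite almost everywhere.
\<close>
lemma AE_tendsto_zero_of_summable:
  fixes f :: "nat \<Rightarrow> 'a \<Rightarrow> real"
  assumes [measurable]: "\<And>j. f j \<in> borel_measurable M" and nonneg: "\<And>j x. 0 \<le> f j x"
    and le: "\<And>j. (\<integral>\<^sup>+x. ennreal (f j x) \<partial>M) \<le> ennreal ((1/2)^j)"
  shows "AE x in M. (\<lambda>j. f j x) \<longlonglongrightarrow> 0"
proof -
  have "(\<integral>\<^sup>+x. (\<Sum>j. ennreal (f j x)) \<partial>M) = (\<Sum>j. \<integral>\<^sup>+x. ennreal (f j x) \<partial>M)"
    by (rule nn_integral_suminf) measurable
  also have "\<dots> \<le> (\<Sum>j. ennreal ((1/2)^j))" by (intro suminf_le le) auto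
  also have "\<dots> = ennreal (\<Sum>j. (1/2)^j)"
    by (rule suminf_ennreal2) (auto intro: summable_geometric)
  also have "\<dots> < \<infinity>" by simp
  finally have "AE x in M. (\<Sum>j. ennreal (f j x)) \<noteq> \<infinity>" by (intro nn_integral_PInf_AE) auto
  then show ?thesis
  proof eventually_elim
    case (elim x)
    then have "summable (\<lambda>j. f j x)" by (intro summable_suminf_not_top nonneg) simp
    then show ?case by (rule summable_LIMSEQ_zero)
  qed
qed

lemma simple_integrand_times:
  assumes "simple_integrand P w t K \<tau> \<phi>" "j \<le> K"
  shows "0 \<le> \<tau> j" "\<tau> j \<le> t"
proof -
  have mono: "\<And>j. j < K \<Longrightarrow> \<tau> j \<le> \<tau> (Suc j)" and ends: "\<tau> 0 = 0" "\<tau> K = t"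
    using assms(1) by (auto simp: simple_integrand_def)
  have "l \<le> K \<Longrightarrow> \<tau> 0 \<le> \<tau> l" for l
  proof (induction l)
    case (Suc l)
    then show ?case using mono[of l] by simp
  qed simp
  then show "0 \<le> \<tau> j" using assms(2) ends by simp
  have "\<tau> j \<le> \<tau> K"
    using assms(2)
  proof (induction rule: inc_induct)
    case (step n)
    then show ?case using mono[of n] by linarith
  qed simp
  then show "\<tau> j \<le> t" using ends by simp
qed

text \<open>
  The coefficients of a simple integrand must be bounded everywhere. A functional agrees with the
  given coefficient only almost surely, so it is set to \<open>0\<close> where it exceeds the bound. The
  value \<open>0\<close> beyond the last interval makes the functional measurable for every index.
\<close>
lemma simple_integrand_representation:
  fixes \<phi> :: "nat \<Rightarrow> 'w \<Rightarrow> real^'n"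
  assumes "simple_integrand P w t K \<tau> \<phi>"
  shows "\<exists>h. (\<forall>j. h j \<in> borel_measurable (path_space (\<tau> j))) \<and>
    (\<forall>j. \<exists>b. \<forall>x. norm (h j x :: real^'n) \<le> b) \<and> (\<forall>j\<ge>K. h j = (\<lambda>_. 0)) \<and>
    (\<forall>j<K. AE \<omega> in P. \<phi> j \<omega> = h j (trajectory w (\<tau> j) \<omega>))"
proof -
  have "\<exists>h. h \<in> borel_measurable (path_space (\<tau> j)) \<and> (\<exists>b. \<forall>x. norm (h x :: real^'n) \<le> b) \<and>
     (K \<le> j \<longrightarrow> h = (\<lambda>_. 0)) \<and> (j < K \<longrightarrow> (AE \<omega> in P. \<phi> j \<omega> = h (trajectory w (\<tau> j) \<omega>)))" for j
  proof (cases "j < K")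
    case True
    with assms have \<phi>: "\<phi> j \<in> borel_measurable (brownian_filtration P w (\<tau> j))"
      and "\<exists>b. \<forall>\<omega>\<in>space P. norm (\<phi> j \<omega>) \<le> b" by (auto simp: simple_integrand_def)
    then obtain b where b: "\<And>\<omega>. \<omega> \<in> space P \<Longrightarrow> norm (\<phi> j \<omega>) \<le> b" by blast
    obtain h where h[measurable]: "h \<in> borel_measurable (path_space (\<tau> j))"
      and eq: "AE \<omega> in P. \<phi> j \<omega> = h (trajectory w (\<tau> j) \<omega>)"
      using measurable_representation[OF \<phi>] by blast
    \<comment> \<open>Cutting off at \<open>b\<close> changes \<open>h\<close> only on a null set of trajectories.\<close>
    define h' where "h' x = (if norm (h x) \<le> b then h x else 0)" for x
    have "h' \<in> borel_measurable (path_space (\<tau> j))" unfolding h'_def by measurable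
    moreover have "norm (h' x) \<le> max 0 b" for x by (auto simp: h'_def)
    moreover have "AE \<omega> in P. \<phi> j \<omega> = h' (trajectory w (\<tau> j) \<omega>)"
      using eq AE_space
    proof eventually_elim
      case (elim \<omega>)
      then show ?case using b[of \<omega>] by (simp add: h'_def)
    qed
    ultimately show ?thesis using True by (intro exI[of _ h']) auto
  next
    case False
    then show ?thesis by (intro exI[of _ "\<lambda>_. 0"]) auto
  qed
  from choice[OF allI[OF this]] obtain h where "\<forall>j. h j \<in> borel_measurable (path_space (\<tau> j)) \<and>
    (\<exists>b. \<forall>x. norm (h j x :: real^'n) \<le> b) \<and> (K \<le> j \<longrightarrow> h j = (\<lambda>_. 0)) \<and>
    (j < K \<longrightarrow> (AE \<omega> in P. \<phi> j \<omega> = h j (trajectory w (\<tau> j) \<omega>)))" ..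
  then show ?thesis by (intro exI[of _ h]) simp
qed

text \<open>
  Replacing \<open>w\<close> by \<open>v\<close> in the coefficients of the approximating simple integrands gives simple
  integrands over \<open>(Q, v)\<close>. Both mean-square errors are expectations of functionals of the
  trajectory, hence unchanged, and so they still tend to \<open>0\<close>.
\<close>
lemma (in brownian_pair) has_ito_integral_transport:
  fixes \<xi> :: "real \<Rightarrow> 'a \<Rightarrow> real^'n"
  assumes ito: "has_ito_integral P w i \<xi> t X" and t: "0 \<le> t" "t \<le> T"
    and g[measurable]: "g \<in> borel_measurable (borel \<Otimes>\<^sub>M path_space T)"
    and \<xi>: "AE \<omega> in P. \<forall>s\<in>{0..T}. \<xi> s \<omega> = g (s, trajectory w T \<omega>)"
  obtains f where "f \<in> borel_measurable (path_space t)"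
    "AE \<omega> in P. X \<omega> = f (trajectory w t \<omega>)"
    "has_ito_integral Q v i (\<lambda>s \<omega>. g (s, trajectory v T \<omega>)) t (\<lambda>\<omega>. f (trajectory v t \<omega>))"
proof -
  from ito obtain K \<tau> \<phi> where X: "X \<in> borel_measurable (brownian_filtration P w t)"
    and simple: "\<And>k. simple_integrand P w t (K k) (\<tau> k) (\<phi> k)"
    and lim\<xi>: "(\<lambda>k. \<integral>\<^sup>+\<omega>. (\<integral>\<^sup>+s\<in>{0..t}.
            ennreal ((norm (simple_process (K k) (\<tau> k) (\<phi> k) s \<omega> - \<xi> s \<omega>))\<^sup>2) \<partial>lborel) \<partial>P)
          \<longlonglongrightarrow> 0"
    and limX: "(\<lambda>k. \<integral>\<^sup>+\<omega>.
            ennreal ((norm (simple_ito_integral w i (K k) (\<tau> k) (\<phi> k) \<omega> - X \<omega>))\<^sup>2) \<partial>P)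
          \<longlonglongrightarrow> 0"
    unfolding has_ito_integral_def by blast
  obtain f where f: "f \<in> borel_measurable (path_space t)"
    and Xf: "AE \<omega> in P. X \<omega> = f (trajectory w t \<omega>)"
    using measurable_representation[OF X] by blast
  have fT[measurable]: "(\<lambda>x. f (restrict x {0..t})) \<in> borel_measurable (path_space T)"
    by (rule measurable_trajectory_restrict[OF f t(2)])
  from choice[OF allI[OF simple_integrand_representation[OF simple]]]
  obtain h where h: "\<forall>k. (\<forall>j. h k j \<in> borel_measurable (path_space (\<tau> k j))) \<and>
    (\<forall>j. \<exists>b. \<forall>x. norm (h k j x :: real^'n) \<le> b) \<and> (\<forall>j\<ge>K k. h k j = (\<lambda>_. 0)) \<and>
    (\<forall>j<K k. AE \<omega> in P. \<phi> k j \<omega> = h k j (trajectory w (\<tau> k j) \<omega>))" ..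
  have hm: "h k j \<in> borel_measurable (path_space (\<tau> k j))" for k j using h by blast
  have h\<phi>: "AE \<omega> in P. \<phi> k j \<omega> = h k j (trajectory w (\<tau> k j) \<omega>)" if "j < K k" for k j
    using h that by blast
  have \<tau>: "0 \<le> \<tau> k j" "\<tau> k j \<le> t" if "j \<le> K k" for k j
    using simple_integrand_times[OF simple that] by auto
  \<comment> \<open>The same functionals, read as functions of the trajectory on the whole of \<open>{0..T}\<close>.\<close>
  define hT where "hT k j x = h k j (restrict x {0..\<tau> k j})" for k j x
  have hTm[measurable]: "hT k j \<in> borel_measurable (path_space T)" for k j
  proof (cases "j < K k")
    case True
    then show ?thesis unfolding hT_def
      using \<tau>[of j k] t by (intro measurable_trajectory_restrict[OF hm]) auto
  next
    case False
    with h have "h k j = (\<lambda>_. 0)" by auto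
    then have "hT k j = (\<lambda>_. 0)" by (simp add: hT_def fun_eq_iff)
    then show ?thesis by simp
  qed
  define \<psi> where "\<psi> k j \<omega> = h k j (trajectory v (\<tau> k j) \<omega>)" for k j \<omega>
  have hT: "hT k j (trajectory u T \<omega>) = h k j (trajectory u (\<tau> k j) \<omega>)" if "j \<le> K k"
    for k j \<omega> and u :: "real \<Rightarrow> 'c \<Rightarrow> real^'d"
    using \<tau>[OF that] t by (simp add: hT_def restrict_trajectory)
  have simple\<psi>: "simple_integrand Q v t (K k) (\<tau> k) (\<psi> k)" for k
  proof -
    have "\<psi> k j \<in> borel_measurable (brownian_filtration Q v (\<tau> k j))" for j
      unfolding \<psi>_def by (rule measurable_compose[OF measurable_trajectory_brownian hm])
    moreover have "\<exists>b. \<forall>\<omega>\<in>space Q. norm (\<psi> k j \<omega>) \<le> b" for j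
    proof -
      obtain b where "\<forall>x. norm (h k j x) \<le> b" using h by blast
      then show ?thesis unfolding \<psi>_def by auto
    qed
    ultimately show ?thesis using simple[of k] by (simp add: simple_integrand_def)
  qed
  have AE\<phi>: "AE \<omega> in P. \<forall>k. \<forall>j\<in>{..<K k}. \<phi> k j \<omega> = h k j (trajectory w (\<tau> k j) \<omega>)"
    unfolding AE_all_countable by (rule allI, rule AE_finite_allI) (use h\<phi> in auto)
  \<comment> \<open>The two errors in the definition of the Ito integral, as functionals of the trajectory.\<close>
  define E1 where "E1 k x = (\<integral>\<^sup>+s\<in>{0..t}. ennreal ((norm
     ((\<Sum>j<K k. indicator {\<tau> k j <.. \<tau> k (Suc j)} s *\<^sub>R hT k j x) - g (s, x)))\<^sup>2) \<partial>lborel)" for k x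
  define E2 where "E2 k x = ennreal ((norm
     ((\<Sum>j<K k. (x (\<tau> k (Suc j)) $ i - x (\<tau> k j) $ i) *\<^sub>R hT k j x) - f (restrict x {0..t})))\<^sup>2)"
    for k and x :: "real \<Rightarrow> real^'d"
  have E1m: "E1 k \<in> borel_measurable (path_space T)" for k
    unfolding E1_def by measurable
  have E2m: "E2 k \<in> borel_measurable (path_space T)" for k
  proof -
    have "(\<lambda>x :: real \<Rightarrow> real^'d. x (\<tau> k j) $ i) \<in> borel_measurable (path_space T)" if "j \<le> K k" for j
      by (rule measurable_compose[OF measurable_component_singleton[of _ _ "\<lambda>_. borel"] borel_measurable_nth])
         (use \<tau>[OF that] t in auto)
    then have "(\<lambda>x :: real \<Rightarrow> real^'d. \<Sum>j<K k. (x (\<tau> k (Suc j)) $ i - x (\<tau> k j) $ i) *\<^sub>R hT k j x)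
        \<in> borel_measurable (path_space T)"
      by (intro borel_measurable_sum borel_measurable_scaleR borel_measurable_diff hTm) auto
    then show ?thesis unfolding E2_def by measurable
  qed
  have "(\<integral>\<^sup>+\<omega>. (\<integral>\<^sup>+s\<in>{0..t}.
      ennreal ((norm (simple_process (K k) (\<tau> k) (\<phi> k) s \<omega> - \<xi> s \<omega>))\<^sup>2) \<partial>lborel) \<partial>P) =
    (\<integral>\<^sup>+\<omega>. E1 k (trajectory w T \<omega>) \<partial>P)" for k
  proof (rule nn_integral_cong_AE)
    show "AE \<omega> in P. (\<integral>\<^sup>+s\<in>{0..t}.
        ennreal ((norm (simple_process (K k) (\<tau> k) (\<phi> k) s \<omega> - \<xi> s \<omega>))\<^sup>2) \<partial>lborel) =
        E1 k (trajectory w T \<omega>)"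
      using AE\<phi> \<xi>
    proof eventually_elim
      case (elim \<omega>)
      then show ?case
        unfolding E1_def simple_process_def
        by (intro nn_integral_cong) (use t in \<open>auto simp: hT split: split_indicator\<close>)
    qed
  qed
  moreover have "(\<integral>\<^sup>+\<omega>. (\<integral>\<^sup>+s\<in>{0..t}. ennreal ((norm (simple_process (K k) (\<tau> k) (\<psi> k) s \<omega> -
      g (s, trajectory v T \<omega>)))\<^sup>2) \<partial>lborel) \<partial>Q) = (\<integral>\<^sup>+\<omega>. E1 k (trajectory v T \<omega>) \<partial>Q)" for k
    unfolding E1_def simple_process_def
    by (intro nn_integral_cong) (auto simp: hT \<psi>_def)
  ultimately have lim1: "(\<lambda>k. \<integral>\<^sup>+\<omega>. (\<integral>\<^sup>+s\<in>{0..t}. ennreal ((norm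
      (simple_process (K k) (\<tau> k) (\<psi> k) s \<omega> - g (s, trajectory v T \<omega>)))\<^sup>2) \<partial>lborel) \<partial>Q) \<longlonglongrightarrow> 0"
    using lim\<xi> nn_integral_transport[OF E1m] by simp
  have tr: "trajectory u T \<omega> (\<tau> k j) = u (\<tau> k j) \<omega>" if "j \<le> K k"
    for k j \<omega> and u :: "real \<Rightarrow> 'c \<Rightarrow> real^'d"
    using \<tau>[OF that] t by (simp add: trajectory_def)
  have "(\<integral>\<^sup>+\<omega>. ennreal ((norm (simple_ito_integral w i (K k) (\<tau> k) (\<phi> k) \<omega> - X \<omega>))\<^sup>2) \<partial>P) =
    (\<integral>\<^sup>+\<omega>. E2 k (trajectory w T \<omega>) \<partial>P)" for k
  proof (rule nn_integral_cong_AE)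
    show "AE \<omega> in P. ennreal ((norm (simple_ito_integral w i (K k) (\<tau> k) (\<phi> k) \<omega> - X \<omega>))\<^sup>2) =
        E2 k (trajectory w T \<omega>)"
      using AE\<phi> Xf
    proof eventually_elim
      case (elim \<omega>)
      then show ?case
        unfolding E2_def simple_ito_integral_def
        using t by (simp add: hT tr restrict_trajectory less_imp_le Suc_leI)
    qed
  qed
  moreover have "(\<integral>\<^sup>+\<omega>. ennreal ((norm (simple_ito_integral v i (K k) (\<tau> k) (\<psi> k) \<omega> -
      f (trajectory v t \<omega>)))\<^sup>2) \<partial>Q) = (\<integral>\<^sup>+\<omega>. E2 k (trajectory v T \<omega>) \<partial>Q)" for k
    unfolding E2_def simple_ito_integral_def
    using t by (intro nn_integral_cong) (simp add: hT tr \<psi>_def restrict_trajectory less_imp_le Suc_leI)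
  ultimately have lim2: "(\<lambda>k. \<integral>\<^sup>+\<omega>. ennreal ((norm
      (simple_ito_integral v i (K k) (\<tau> k) (\<psi> k) \<omega> - f (trajectory v t \<omega>)))\<^sup>2) \<partial>Q) \<longlonglongrightarrow> 0"
    using limX nn_integral_transport[OF E2m] by simp
  have "has_ito_integral Q v i (\<lambda>s \<omega>. g (s, trajectory v T \<omega>)) t (\<lambda>\<omega>. f (trajectory v t \<omega>))"
    unfolding has_ito_integral_def
    using measurable_compose[OF measurable_trajectory_brownian f] simple\<psi> lim1 lim2 by blast
  with f Xf show ?thesis using that by blast
qed

lemma has_ito_integral_cong:
  assumes "has_ito_integral Q v i \<xi> t X"
    and eq: "AE \<omega> in Q. AE s in lborel. s \<in> {0..t} \<longrightarrow> \<xi>' s \<omega> = \<xi> s \<omega>"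
  shows "has_ito_integral Q v i \<xi>' t X"
proof -
  have "(\<integral>\<^sup>+\<omega>. (\<integral>\<^sup>+s\<in>{0..t}. ennreal ((norm (S s \<omega> - \<xi>' s \<omega>))\<^sup>2) \<partial>lborel) \<partial>Q) =
      (\<integral>\<^sup>+\<omega>. (\<integral>\<^sup>+s\<in>{0..t}. ennreal ((norm (S s \<omega> - \<xi> s \<omega>))\<^sup>2) \<partial>lborel) \<partial>Q)" for S
  proof (rule nn_integral_cong_AE)
    show "AE \<omega> in Q. (\<integral>\<^sup>+s\<in>{0..t}. ennreal ((norm (S s \<omega> - \<xi>' s \<omega>))\<^sup>2) \<partial>lborel) =
      (\<integral>\<^sup>+s\<in>{0..t}. ennreal ((norm (S s \<omega> - \<xi> s \<omega>))\<^sup>2) \<partial>lborel)"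
      using eq
    proof eventually_elim
      case (elim \<omega>)
      show ?case
        by (rule nn_integral_cong_AE)
           (use elim in eventually_elim, auto split: split_indicator)
    qed
  qed
  then show ?thesis using assms(1) unfolding has_ito_integral_def by simp
qed

text \<open>
  On \<open>{0..t}\<close> only the coefficients fixed before time \<open>t\<close> contribute.
\<close>
lemma progressive_simple_process:
  assumes "simple_integrand Q v T K \<tau> \<phi>"
  shows "progressive Q v T (simple_process K \<tau> \<phi>)"
  unfolding progressive_def
proof
  fix t assume t: "t \<in> {0..T}"
  let ?N = "restrict_space borel {0..t} \<Otimes>\<^sub>M brownian_filtration Q v t"
  have "(\<lambda>p. indicator {\<tau> j <.. \<tau> (Suc j)} (fst p) *\<^sub>R \<phi> j (snd p)) \<in> borel_measurable ?N"
    if j: "j < K" for j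
  proof (cases "\<tau> j \<le> t")
    case True
    have "\<phi> j \<in> borel_measurable (brownian_filtration Q v t)"
      using assms j by (intro measurable_brownian_mono[OF True]) (auto simp: simple_integrand_def)
    moreover have "(\<lambda>s. indicator {\<tau> j <.. \<tau> (Suc j)} s :: real) \<in> borel_measurable (restrict_space borel {0..t})"
      by (rule measurable_restrict_space1) measurable
    ultimately show ?thesis
      by (intro borel_measurable_scaleR measurable_compose[OF measurable_fst]
            measurable_compose[OF measurable_snd])
  next
    case False
    then have "indicator {\<tau> j <.. \<tau> (Suc j)} (fst p) *\<^sub>R \<phi> j (snd p) = 0" if "p \<in> space ?N" for p
      using that by (auto simp: space_pair_measure space_restrict_space split: split_indicator)
    from measurable_cong[OF this, where M'=borel] show ?thesis by simp
  qed
  then show "(\<lambda>(s, \<omega>). simple_process K \<tau> \<phi> s \<omega>) \<in> borel_measurable ?N"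
    unfolding simple_process_def split_beta' by (intro borel_measurable_sum) auto
qed

text \<open>
  The simple processes that define the Ito integral are progressive and converge to \<open>\<xi>\<close> in mean
  square. A sufficiently fast subsequence converges almost everywhere in \<open>(\<omega>, s)\<close>, and its
  pointwise limit is progressive.
\<close>
lemma has_ito_integral_progressive_version:
  fixes \<xi> :: "real \<Rightarrow> 'w \<Rightarrow> real^'n"
  assumes bm: "standard_brownian_motion Q v"
    and ito: "has_ito_integral Q v i \<xi> T X"
    and \<xi>[measurable]: "(\<lambda>p. \<xi> (snd p) (fst p)) \<in> borel_measurable (Q \<Otimes>\<^sub>M lborel)"
  obtains Z where "progressive Q v T Z"
    "AE \<omega> in Q. AE s in lborel. s \<in> {0..T} \<longrightarrow> Z s \<omega> = \<xi> s \<omega>"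
proof -
  interpret prob_space Q using bm by (rule bm_prob_space)
  interpret pair_sigma_finite Q lborel ..
  from ito obtain K \<tau> \<phi> where
    simple: "\<And>k. simple_integrand Q v T (K k) (\<tau> k) (\<phi> k)"
    and lim: "(\<lambda>k. \<integral>\<^sup>+\<omega>. (\<integral>\<^sup>+s\<in>{0..T}.
            ennreal ((norm (simple_process (K k) (\<tau> k) (\<phi> k) s \<omega> - \<xi> s \<omega>))\<^sup>2) \<partial>lborel) \<partial>Q)
          \<longlonglongrightarrow> 0" (is "?e \<longlonglongrightarrow> 0")
    unfolding has_ito_integral_def by blast
  have "\<forall>j. \<exists>k. ?e k \<le> ennreal ((1/2)^j)"
  proof
    fix j :: nat
    have "\<forall>\<^sub>F k in sequentially. ?e k < ennreal ((1/2)^j)"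
      by (rule order_tendstoD(2)[OF lim]) simp
    then show "\<exists>k. ?e k \<le> ennreal ((1/2)^j)"
      by (auto simp: eventually_sequentially intro: less_imp_le)
  qed
  from choice[OF this] obtain r where r: "\<And>j. ?e (r j) \<le> ennreal ((1/2)^j)" by auto
  define S where "S j = simple_process (K (r j)) (\<tau> (r j)) (\<phi> (r j))" for j
  have S[measurable]: "(\<lambda>p. S j (snd p) (fst p)) \<in> borel_measurable (Q \<Otimes>\<^sub>M lborel)" for j
  proof -
    have "\<phi> (r j) l \<in> borel_measurable Q" if "l < K (r j)" for l
      using simple[of "r j"] that
      by (intro measurable_from_brownian[OF bm]) (auto simp: simple_integrand_def)
    then show ?thesis
      unfolding S_def simple_process_def
      by (intro borel_measurable_sum borel_measurable_scaleR
            measurable_compose[OF measurable_snd] measurable_compose[OF measurable_fst]) auto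
  qed
  define d where "d j p = indicator {0..T} (snd p) * (norm (S j (snd p) (fst p) - \<xi> (snd p) (fst p)))\<^sup>2"
    for j p
  have dm[measurable]: "d j \<in> borel_measurable (Q \<Otimes>\<^sub>M lborel)" for j
    unfolding d_def by measurable
  have dr: "(\<integral>\<^sup>+p. ennreal (d j p) \<partial>(Q \<Otimes>\<^sub>M lborel)) = ?e (r j)" for j
  proof -
    have "(\<lambda>p. ennreal (d j p)) \<in> borel_measurable (Q \<Otimes>\<^sub>M lborel)" by measurable
    from lborel.nn_integral_fst[OF this, symmetric] show ?thesis
      by (auto intro!: nn_integral_cong simp: d_def S_def split: split_indicator)
  qed
  have "AE p in Q \<Otimes>\<^sub>M lborel. (\<lambda>j. d j p) \<longlonglongrightarrow> 0"
  proof (rule AE_tendsto_zero_of_summable[OF dm])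
    show "(\<integral>\<^sup>+p. ennreal (d j p) \<partial>(Q \<Otimes>\<^sub>M lborel)) \<le> ennreal ((1/2)^j)" for j
      unfolding dr by (rule r)
  qed (simp add: d_def)
  from AE_pair[OF this] have AE: "AE \<omega> in Q. AE s in lborel. (\<lambda>j. d j (\<omega>, s)) \<longlonglongrightarrow> 0" .
  have *: "lim (\<lambda>j. S j s \<omega>) = \<xi> s \<omega>" if "(\<lambda>j. d j (\<omega>, s)) \<longlonglongrightarrow> 0" "s \<in> {0..T}" for s \<omega>
  proof -
    have "(\<lambda>j. (norm (S j s \<omega> - \<xi> s \<omega>))\<^sup>2) \<longlonglongrightarrow> 0" using that by (simp add: d_def)
    from tendsto_real_sqrt[OF this] have "(\<lambda>j. S j s \<omega> - \<xi> s \<omega>) \<longlonglongrightarrow> 0"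
      by (simp add: tendsto_norm_zero_iff)
    then show ?thesis by (intro limI) (simp add: LIM_zero_iff)
  qed
  have "progressive Q v T (\<lambda>s \<omega>. lim (\<lambda>j. S j s \<omega>))"
    unfolding S_def by (intro progressive_lim progressive_simple_process simple)
  moreover have "AE \<omega> in Q. AE s in lborel. s \<in> {0..T} \<longrightarrow> lim (\<lambda>j. S j s \<omega>) = \<xi> s \<omega>"
    using AE
  proof eventually_elim
    case (elim \<omega>)
    then show ?case by eventually_elim (use * in blast)
  qed
  ultimately show ?thesis using that by blast
qed

section \<open>Transport of mean-square continuous processes\<close>

lemma norm_diff_square_le: "(norm (a - b))\<^sup>2 \<le> 2 * (norm a)\<^sup>2 + 2 * (norm b)\<^sup>2"
  for a b :: "'a::real_normed_vector"
proof -
  have "(norm (a - b))\<^sup>2 \<le> (norm a + norm b)\<^sup>2"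
    by (rule power_mono[OF norm_triangle_ineq4]) simp
  also have "\<dots> \<le> 2 * (norm a)\<^sup>2 + 2 * (norm b)\<^sup>2"
    using sum_squares_bound[of "norm a" "norm b"] by (simp add: power2_sum)
  finally show ?thesis .
qed

lemma integrable_norm_diff_square:
  fixes X Y :: "'a \<Rightarrow> 'b::{second_countable_topology, real_normed_vector}"
  assumes [measurable]: "X \<in> borel_measurable M" "Y \<in> borel_measurable M"
    and "integrable M (\<lambda>\<omega>. (norm (X \<omega>))\<^sup>2)" "integrable M (\<lambda>\<omega>. (norm (Y \<omega>))\<^sup>2)"
  shows "integrable M (\<lambda>\<omega>. (norm (X \<omega> - Y \<omega>))\<^sup>2)"
proof (rule Bochner_Integration.integrable_bound)
  show "integrable M (\<lambda>\<omega>. 2 * (norm (X \<omega>))\<^sup>2 + 2 * (norm (Y \<omega>))\<^sup>2)" using assms by simp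
  show "AE \<omega> in M. norm ((norm (X \<omega> - Y \<omega>))\<^sup>2) \<le> norm (2 * (norm (X \<omega>))\<^sup>2 + 2 * (norm (Y \<omega>))\<^sup>2)"
    by (intro AE_I2) (simp add: norm_diff_square_le)
qed measurable

lemma C_proc_measurable:
  assumes "standard_brownian_motion P w" "\<xi> \<in> C_proc P w T" "t \<in> {0..T}"
  shows "\<xi> t \<in> borel_measurable P"
  using assms by (intro measurable_from_brownian[OF assms(1)]) (auto simp: C_proc_def)

lemma C_proc_integrable_diff:
  assumes "standard_brownian_motion P w" "\<xi> \<in> C_proc P w T" "s \<in> {0..T}" "t \<in> {0..T}"
  shows "integrable P (\<lambda>\<omega>. (norm (\<xi> s \<omega> - \<xi> t \<omega>))\<^sup>2)"
  using assms by (intro integrable_norm_diff_square C_proc_measurable[OF assms(1,2)])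
    (auto simp: C_proc_def L2_rv_def)

text \<open>
  The Heine-Cantor argument. The squared mean-square distance is not a metric, but
  \<open>norm_diff_square_le\<close> gives the triangle inequality up to a factor \<open>2\<close>, which is enough for the
  argument with convergent subsequences.
\<close>
lemma C_proc_uniformly_continuous:
  assumes bm: "standard_brownian_motion P w" and \<xi>: "\<xi> \<in> C_proc P w T" and \<epsilon>: "0 < \<epsilon>"
  shows "\<exists>\<delta>>0. \<forall>s\<in>{0..T}. \<forall>t\<in>{0..T}. \<bar>s - t\<bar> \<le> \<delta> \<longrightarrow> (\<integral>\<omega>. (norm (\<xi> s \<omega> - \<xi> t \<omega>))\<^sup>2 \<partial>P) \<le> \<epsilon>"
proof (rule ccontr)
  let ?m = "\<lambda>s t. \<integral>\<omega>. (norm (\<xi> s \<omega> - \<xi> t \<omega>))\<^sup>2 \<partial>P"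
  assume "\<not> ?thesis"
  then have *: "\<exists>s\<in>{0..T}. \<exists>t\<in>{0..T}. \<bar>s - t\<bar> \<le> \<delta> \<and> \<epsilon> < ?m s t" if "\<delta> > 0" for \<delta>
    using that by (auto simp: not_le)
  have "\<forall>n. \<exists>z. fst z \<in> {0..T} \<and> snd z \<in> {0..T} \<and>
      \<bar>fst z - snd z\<bar> \<le> inverse (real (Suc n)) \<and> \<epsilon> < ?m (fst z) (snd z)"
  proof
    fix n :: nat
    have "0 < inverse (real (Suc n))" by simp
    from *[OF this] obtain s t where "s \<in> {0..T}" "t \<in> {0..T}"
      "\<bar>s - t\<bar> \<le> inverse (real (Suc n))" "\<epsilon> < ?m s t" by blast
    then show "\<exists>z. fst z \<in> {0..T} \<and> snd z \<in> {0..T} \<and>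
      \<bar>fst z - snd z\<bar> \<le> inverse (real (Suc n)) \<and> \<epsilon> < ?m (fst z) (snd z)"
      by (intro exI[of _ "(s, t)"]) simp
  qed
  from choice[OF this] obtain z where z: "\<forall>n. fst (z n) \<in> {0..T} \<and> snd (z n) \<in> {0..T} \<and>
      \<bar>fst (z n) - snd (z n)\<bar> \<le> inverse (real (Suc n)) \<and> \<epsilon> < ?m (fst (z n)) (snd (z n))" ..
  define s where "s n = fst (z n)" for n
  define t where "t n = snd (z n)" for n
  have s: "s n \<in> {0..T}" and t: "t n \<in> {0..T}"
    and st: "\<bar>s n - t n\<bar> \<le> inverse (real (Suc n))" and m: "\<epsilon> < ?m (s n) (t n)" for n
    using z by (simp_all add: s_def t_def)
  obtain l r where l: "l \<in> {0..T}" and r: "strict_mono (r :: nat \<Rightarrow> nat)" and sl: "(s \<circ> r) \<longlonglongrightarrow> l"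
    using s compact_Icc[of 0 T] unfolding compact_def by metis
  have "(\<lambda>n. s n - t n) \<longlonglongrightarrow> 0"
    by (rule Lim_null_comparison[OF _ LIMSEQ_inverse_real_of_nat]) (use st in auto)
  from tendsto_diff[OF sl LIMSEQ_subseq_LIMSEQ[OF this r]] have tl: "(t \<circ> r) \<longlonglongrightarrow> l"
    by (simp add: o_def)
  have cont: "continuous (at l within {0..T}) (\<lambda>s. ?m s l)"
    using \<xi> l by (auto simp: continuous_within C_proc_def)
  have "(\<lambda>n. ?m ((s \<circ> r) n) l) \<longlonglongrightarrow> ?m l l"
    by (rule continuous_within_tendsto_compose'[OF cont _ sl]) (use s in auto)
  moreover have "(\<lambda>n. ?m ((t \<circ> r) n) l) \<longlonglongrightarrow> ?m l l"
    by (rule continuous_within_tendsto_compose'[OF cont _ tl]) (use t in auto)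
  ultimately have lim: "(\<lambda>n. 2 * ?m ((s \<circ> r) n) l + 2 * ?m ((t \<circ> r) n) l) \<longlonglongrightarrow> 2 * ?m l l + 2 * ?m l l"
    by (intro tendsto_intros)
  have "\<epsilon> \<le> 2 * ?m ((s \<circ> r) n) l + 2 * ?m ((t \<circ> r) n) l" for n
  proof -
    note int = C_proc_integrable_diff[OF bm \<xi>]
    have "?m ((s \<circ> r) n) ((t \<circ> r) n) \<le> (\<integral>\<omega>. 2 * (norm (\<xi> ((s \<circ> r) n) \<omega> - \<xi> l \<omega>))\<^sup>2 +
        2 * (norm (\<xi> ((t \<circ> r) n) \<omega> - \<xi> l \<omega>))\<^sup>2 \<partial>P)"
    proof (rule integral_mono)
      show "(norm (\<xi> ((s \<circ> r) n) \<omega> - \<xi> ((t \<circ> r) n) \<omega>))\<^sup>2 \<le>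
          2 * (norm (\<xi> ((s \<circ> r) n) \<omega> - \<xi> l \<omega>))\<^sup>2 + 2 * (norm (\<xi> ((t \<circ> r) n) \<omega> - \<xi> l \<omega>))\<^sup>2" for \<omega>
        using norm_diff_square_le[of "\<xi> ((s \<circ> r) n) \<omega> - \<xi> l \<omega>" "\<xi> ((t \<circ> r) n) \<omega> - \<xi> l \<omega>"] by simp
    qed (use int s t l in auto)
    also have "\<dots> = 2 * ?m ((s \<circ> r) n) l + 2 * ?m ((t \<circ> r) n) l"
      using int s t l by simp
    finally show ?thesis using m[of "r n"] by simp
  qed
  then have "\<epsilon> \<le> 2 * ?m l l + 2 * ?m l l"
    by (intro LIMSEQ_le_const[OF lim]) auto
  then show False using \<epsilon> by simp
qed

lemma grid_point:
  fixes s \<delta> :: real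
  assumes "0 < \<delta>"
  shows "\<delta> * of_int \<lfloor>s / \<delta>\<rfloor> \<le> s" "s \<le> \<delta> * of_int \<lfloor>s / \<delta>\<rfloor> + \<delta>"
    "0 \<le> s \<Longrightarrow> 0 \<le> \<delta> * of_int \<lfloor>s / \<delta>\<rfloor>"
proof -
  have "of_int \<lfloor>s / \<delta>\<rfloor> \<le> s / \<delta>" by simp
  then show "\<delta> * of_int \<lfloor>s / \<delta>\<rfloor> \<le> s"
    using assms by (simp only: pos_le_divide_eq mult.commute)
  have "s / \<delta> \<le> of_int \<lfloor>s / \<delta>\<rfloor> + 1" by linarith
  then have "s \<le> (of_int \<lfloor>s / \<delta>\<rfloor> + 1) * \<delta>"
    using assms by (simp only: pos_divide_le_eq)
  then show "s \<le> \<delta> * of_int \<lfloor>s / \<delta>\<rfloor> + \<delta>" by (simp add: algebra_simps)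
qed (use assms in simp)

text \<open>
  The process is frozen at the last grid point before the current time, so it never looks ahead.
\<close>
lemma progressive_grid_process:
  assumes F: "\<And>r. r \<in> {0..T} \<Longrightarrow> F r \<in> borel_measurable (brownian_filtration Q v r)" and \<delta>: "0 < \<delta>"
  shows "progressive Q v T (\<lambda>s. F (\<delta> * of_int \<lfloor>s / \<delta>\<rfloor>))"
  unfolding progressive_def
proof
  fix t assume t: "t \<in> {0..T}"
  let ?N = "restrict_space borel {0..t} \<Otimes>\<^sub>M brownian_filtration Q v t"
  \<comment> \<open>Cutting off at \<open>t\<close> does not change the process on \<open>{0..t}\<close>, but makes the value at every
    index measurable at time \<open>t\<close>.\<close>
  define r where "r n = max 0 (min (\<delta> * of_int n) t)" for n :: int
  have "(\<lambda>p. F (r n) (snd p)) \<in> borel_measurable ?N" for n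
  proof -
    have "r n \<in> {0..T}" "r n \<le> t" using t by (auto simp: r_def)
    then show ?thesis
      by (intro measurable_compose[OF measurable_snd] measurable_brownian_mono[OF _ F]) auto
  qed
  moreover have "(\<lambda>p. \<lfloor>fst p / \<delta>\<rfloor>) \<in> measurable ?N (count_space UNIV)"
  proof (rule measurable_compose[OF measurable_fst])
    show "(\<lambda>s. \<lfloor>s / \<delta>\<rfloor>) \<in> measurable (restrict_space borel {0..t}) (count_space UNIV)"
      by (rule measurable_restrict_space1) measurable
  qed
  ultimately have Fr: "(\<lambda>p. F (r \<lfloor>fst p / \<delta>\<rfloor>) (snd p)) \<in> borel_measurable ?N"
    by (rule measurable_compose_countable)
  have eq: "F (r \<lfloor>fst p / \<delta>\<rfloor>) (snd p) = F (\<delta> * of_int \<lfloor>fst p / \<delta>\<rfloor>) (snd p)"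
    if "p \<in> space ?N" for p
  proof -
    have p: "0 \<le> fst p" "fst p \<le> t"
      using that by (auto simp: space_pair_measure space_restrict_space)
    moreover have "\<delta> * of_int \<lfloor>fst p / \<delta>\<rfloor> \<le> fst p" "0 \<le> \<delta> * of_int \<lfloor>fst p / \<delta>\<rfloor>"
      using grid_point[OF \<delta>] p by auto
    ultimately show ?thesis using p by (simp add: r_def)
  qed
  show "(\<lambda>(s, \<omega>). F (\<delta> * of_int \<lfloor>s / \<delta>\<rfloor>) \<omega>) \<in> borel_measurable ?N"
    unfolding split_beta' by (rule iffD1[OF measurable_cong[OF eq] Fr])
qed

lemma measurable_section:
  assumes "g \<in> borel_measurable (borel \<Otimes>\<^sub>M path_space T)"
  shows "(\<lambda>x. g (s, x)) \<in> borel_measurable (path_space T)"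
  by (rule measurable_compose[OF measurable_Pair1' assms]) simp

text \<open>
  For each \<open>j\<close> the grid is so fine that the step process is within \<open>(1/2)^j\<close> of the target in mean
  square, uniformly in time. The errors are summable, so the same sequence converges almost surely
  at every fixed time; the adapted version is its pointwise limit.
\<close>
lemma (in brownian_pair) mean_square_continuous_version:
  fixes y :: "real \<Rightarrow> 'a \<Rightarrow> real^'n"
  assumes y: "y \<in> C_proc P w T"
    and g: "g \<in> borel_measurable (borel \<Otimes>\<^sub>M path_space T)"
    and yg: "AE \<omega> in P. \<forall>s\<in>{0..T}. y s \<omega> = g (s, trajectory w T \<omega>)"
  obtains y' where "progressive Q v T y'"
    "\<forall>s\<in>{0..T}. AE \<omega> in Q. y' s \<omega> = g (s, trajectory v T \<omega>)"
proof -
  have "\<exists>f. f \<in> borel_measurable (path_space r) \<and> (AE \<omega> in P. y r \<omega> = f (trajectory w r \<omega>))"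
    if "r \<in> {0..T}" for r
  proof -
    have "y r \<in> borel_measurable (brownian_filtration P w r)" using y that by (simp add: C_proc_def)
    then show ?thesis by (rule measurable_representation) blast
  qed
  then have "\<forall>r\<in>{0..T}. \<exists>f. f \<in> borel_measurable (path_space r) \<and>
      (AE \<omega> in P. y r \<omega> = f (trajectory w r \<omega>))" by blast
  from bchoice[OF this] obtain f
    where f: "\<And>r. r \<in> {0..T} \<Longrightarrow> f r \<in> borel_measurable (path_space r)"
      and yf: "\<And>r. r \<in> {0..T} \<Longrightarrow> AE \<omega> in P. y r \<omega> = f r (trajectory w r \<omega>)"
    by blast
  have "\<forall>j::nat. \<exists>\<delta>>0. \<forall>s\<in>{0..T}. \<forall>t\<in>{0..T}. \<bar>s - t\<bar> \<le> \<delta> \<longrightarrow>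
      (\<integral>\<omega>. (norm (y s \<omega> - y t \<omega>))\<^sup>2 \<partial>P) \<le> (1/2)^j"
    by (intro allI C_proc_uniformly_continuous[OF bmP y]) simp
  from choice[OF this] obtain \<delta> where \<delta>: "\<And>j::nat. 0 < \<delta> j" and uc: "\<And>j s t. s \<in> {0..T} \<Longrightarrow> t \<in> {0..T} \<Longrightarrow>
      \<bar>s - t\<bar> \<le> \<delta> j \<Longrightarrow> (\<integral>\<omega>. (norm (y s \<omega> - y t \<omega>))\<^sup>2 \<partial>P) \<le> (1/2)^j"
    by blast
  define F where "F r \<omega> = f r (trajectory v r \<omega>)" for r \<omega>
  define \<pi> where "\<pi> j s = \<delta> j * of_int \<lfloor>s / \<delta> j\<rfloor>" for j s
  have prog: "progressive Q v T (\<lambda>s. F (\<pi> j s))" for j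
    unfolding \<pi>_def
  proof (rule progressive_grid_process[OF _ \<delta>])
    show "F r \<in> borel_measurable (brownian_filtration Q v r)" if "r \<in> {0..T}" for r
      unfolding F_def by (rule measurable_compose[OF measurable_trajectory_brownian f[OF that]])
  qed
  have AE: "AE \<omega> in Q. lim (\<lambda>j. F (\<pi> j s) \<omega>) = g (s, trajectory v T \<omega>)" if s: "s \<in> {0..T}" for s
  proof -
    have \<pi>: "\<pi> j s \<in> {0..T}" "\<bar>\<pi> j s - s\<bar> \<le> \<delta> j" for j
    proof -
      show "\<pi> j s \<in> {0..T}" "\<bar>\<pi> j s - s\<bar> \<le> \<delta> j"
        using grid_point[OF \<delta>[of j], of s] s by (auto simp: \<pi>_def)
    qed
    have gs[measurable]: "(\<lambda>x. g (s, x)) \<in> borel_measurable (path_space T)"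
      by (rule measurable_section[OF g])
    have fT[measurable]: "(\<lambda>x. f (\<pi> j s) (restrict x {0..\<pi> j s})) \<in> borel_measurable (path_space T)" for j
      using \<pi>[of j] by (intro measurable_trajectory_restrict[OF f]) auto
    have FT: "F (\<pi> j s) \<omega> = f (\<pi> j s) (restrict (trajectory v T \<omega>) {0..\<pi> j s})" for j \<omega>
      using \<pi>[of j] by (simp add: F_def restrict_trajectory)
    define H where "H j x = (norm (f (\<pi> j s) (restrict x {0..\<pi> j s}) - g (s, x)))\<^sup>2" for j x
    have H[measurable]: "H j \<in> borel_measurable (path_space T)" for j
      unfolding H_def by measurable
    have "AE \<omega> in Q. (\<lambda>j. H j (trajectory v T \<omega>)) \<longlonglongrightarrow> 0"
    proof (rule AE_tendsto_zero_of_summable)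
      fix j
      have "(\<integral>\<^sup>+\<omega>. ennreal (H j (trajectory v T \<omega>)) \<partial>Q) = (\<integral>\<^sup>+\<omega>. ennreal (H j (trajectory w T \<omega>)) \<partial>P)"
        by (rule nn_integral_transport[symmetric]) measurable
      also have "\<dots> = (\<integral>\<^sup>+\<omega>. ennreal ((norm (y (\<pi> j s) \<omega> - y s \<omega>))\<^sup>2) \<partial>P)"
      proof (rule nn_integral_cong_AE)
        show "AE \<omega> in P. ennreal (H j (trajectory w T \<omega>)) = ennreal ((norm (y (\<pi> j s) \<omega> - y s \<omega>))\<^sup>2)"
          using yg yf[OF \<pi>(1)[of j]]
          by eventually_elim (use s \<pi>[of j] in \<open>simp add: H_def restrict_trajectory\<close>)
      qed
      also have "\<dots> = ennreal (\<integral>\<omega>. (norm (y (\<pi> j s) \<omega> - y s \<omega>))\<^sup>2 \<partial>P)"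
        by (rule nn_integral_eq_integral[OF C_proc_integrable_diff[OF bmP y \<pi>(1) s]]) simp
      also have "\<dots> \<le> ennreal ((1/2)^j)"
        by (rule ennreal_leI[OF uc[OF \<pi>(1) s \<pi>(2)]])
      finally show "(\<integral>\<^sup>+\<omega>. ennreal (H j (trajectory v T \<omega>)) \<partial>Q) \<le> ennreal ((1/2)^j)" .
    qed (auto simp: H_def)
    then show ?thesis
    proof eventually_elim
      case (elim \<omega>)
      from tendsto_real_sqrt[OF elim]
      have "(\<lambda>j. F (\<pi> j s) \<omega> - g (s, trajectory v T \<omega>)) \<longlonglongrightarrow> 0"
        by (simp add: H_def FT tendsto_norm_zero_iff)
      then show ?case by (intro limI) (simp add: LIM_zero_iff)
    qed
  qed
  show ?thesis by (rule that[OF progressive_lim[OF prog] ballI[OF AE]])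
qed

section \<open>Time integrals along functionals of the trajectory\<close>

text \<open>
  Equality at almost every time, almost surely. This is what the \<open>ds\<close>-integrals see, and it is
  what an almost everywhere limit of simple processes provides.
\<close>
definition path_functional ::
  "'w measure \<Rightarrow> (real \<Rightarrow> 'w \<Rightarrow> real^'d) \<Rightarrow> real \<Rightarrow> (real \<Rightarrow> 'w \<Rightarrow> 'c) \<Rightarrow>
   (real \<times> (real \<Rightarrow> real^'d) \<Rightarrow> 'c) \<Rightarrow> bool" where
  "path_functional P w T \<xi> g \<longleftrightarrow>
     (AE \<omega> in P. AE s in lborel. s \<in> {0..T} \<longrightarrow> \<xi> s \<omega> = g (s, trajectory w T \<omega>))"

lemma path_functionalI:
  "AE \<omega> in P. \<forall>s\<in>{0..T}. \<xi> s \<omega> = g (s, trajectory w T \<omega>) \<Longrightarrow> path_functional P w T \<xi> g"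
  unfolding path_functional_def by (auto elim!: eventually_mono)

text \<open>
  Bochner integrals of almost everywhere equal functions can differ when one of the functions is
  not measurable. Joint measurability supplies the measurability of the sections in time and, by
  Fubini, of their integrals.
\<close>
definition jointly_measurable ::
  "'w measure \<Rightarrow> real \<Rightarrow> (real \<Rightarrow> 'w \<Rightarrow> 'c::topological_space) \<Rightarrow> bool" where
  "jointly_measurable P T \<xi> \<longleftrightarrow>
     (\<lambda>p. \<xi> (clamp_time T (snd p)) (fst p)) \<in> borel_measurable (P \<Otimes>\<^sub>M lborel)"

lemma progressive_imp_jointly_measurable:
  assumes bm: "standard_brownian_motion P w" and \<xi>: "progressive P w T \<xi>" and T: "0 \<le> T"
  shows "jointly_measurable P T \<xi>"
proof -
  have "(\<lambda>\<omega>. \<omega>) \<in> measurable P (brownian_filtration P w T)"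
    by (rule measurable_from_brownian[OF bm measurable_ident_sets[OF refl]])
  then have "(\<lambda>p. (snd p, fst p)) \<in> measurable (P \<Otimes>\<^sub>M lborel) (borel \<Otimes>\<^sub>M brownian_filtration P w T)"
    by (intro measurable_Pair measurable_compose[OF measurable_fst]) auto
  from measurable_compose[OF this progressive_jointly_measurable[OF \<xi> T]] show ?thesis
    by (simp add: jointly_measurable_def)
qed

lemma measurable_along_trajectory:
  assumes "standard_brownian_motion P w" "g \<in> borel_measurable (borel \<Otimes>\<^sub>M path_space T)"
  shows "(\<lambda>p. g (snd p, trajectory w T (fst p))) \<in> borel_measurable (P \<Otimes>\<^sub>M lborel)"
proof -
  have "(\<lambda>p. (snd p, trajectory w T (fst p))) \<in> measurable (P \<Otimes>\<^sub>M lborel) (borel \<Otimes>\<^sub>M path_space T)"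
    by (intro measurable_Pair measurable_compose[OF measurable_fst measurable_trajectory[OF assms(1)]]) simp
  from measurable_compose[OF this assms(2)] show ?thesis .
qed

lemma time_integral_measurable:
  fixes \<xi> :: "real \<Rightarrow> 'w \<Rightarrow> 'c::{banach, second_countable_topology}"
  assumes \<xi>: "jointly_measurable P T \<xi>" and t: "t \<le> T"
  shows "(\<lambda>\<omega>. LINT s:{0..t}|lborel. \<xi> s \<omega>) \<in> borel_measurable P"
proof -
  have "(\<lambda>(\<omega>, s). indicator {0..t} s *\<^sub>R \<xi> (clamp_time T s) \<omega>) \<in> borel_measurable (P \<Otimes>\<^sub>M lborel)"
    using \<xi> unfolding jointly_measurable_def split_beta' by measurable
  then have "(\<lambda>\<omega>. \<integral>s. indicator {0..t} s *\<^sub>R \<xi> (clamp_time T s) \<omega> \<partial>lborel) \<in> borel_measurable P"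
    by (rule lborel.borel_measurable_lebesgue_integral)
  moreover have "(\<integral>s. indicator {0..t} s *\<^sub>R \<xi> (clamp_time T s) \<omega> \<partial>lborel) =
      (LINT s:{0..t}|lborel. \<xi> s \<omega>)" for \<omega>
    unfolding set_lebesgue_integral_def
    by (rule Bochner_Integration.integral_cong)
       (use t in \<open>auto simp: clamp_time_id split: split_indicator\<close>)
  ultimately show ?thesis by simp
qed

lemma time_integral_functional_measurable:
  fixes g :: "real \<times> (real \<Rightarrow> real^'d) \<Rightarrow> 'c::{banach, second_countable_topology}"
  assumes [measurable]: "g \<in> borel_measurable (borel \<Otimes>\<^sub>M path_space T)"
  shows "(\<lambda>x. LINT s:{0..t}|lborel. g (s, x)) \<in> borel_measurable (path_space T)"
  unfolding set_lebesgue_integral_def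
  by (rule lborel.borel_measurable_lebesgue_integral) measurable

lemma time_integral_functional:
  fixes \<xi> :: "real \<Rightarrow> 'w \<Rightarrow> 'c::{banach, second_countable_topology}"
  assumes bm: "standard_brownian_motion P w"
    and \<xi>: "jointly_measurable P T \<xi>" and t: "t \<le> T"
    and g: "g \<in> borel_measurable (borel \<Otimes>\<^sub>M path_space T)"
    and \<xi>g: "path_functional P w T \<xi> g"
  shows "AE \<omega> in P. (LINT s:{0..t}|lborel. \<xi> s \<omega>) = (LINT s:{0..t}|lborel. g (s, trajectory w T \<omega>))"
  using \<xi>g[unfolded path_functional_def] AE_space
proof eventually_elim
  case (elim \<omega>)
  have [measurable]: "(\<lambda>s. \<xi> (clamp_time T s) \<omega>) \<in> borel_measurable lborel"
    using measurable_compose[OF measurable_Pair1'[OF elim(2)] \<xi>[unfolded jointly_measurable_def]] by simp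
  have [measurable]: "(\<lambda>s. g (s, trajectory w T \<omega>)) \<in> borel_measurable lborel"
    using measurable_compose[OF measurable_Pair1'[OF elim(2)] measurable_along_trajectory[OF bm g]] by simp
  have "(LINT s:{0..t}|lborel. \<xi> s \<omega>) = (\<integral>s. indicator {0..t} s *\<^sub>R \<xi> (clamp_time T s) \<omega> \<partial>lborel)"
    unfolding set_lebesgue_integral_def
    by (rule Bochner_Integration.integral_cong)
       (use t in \<open>auto simp: clamp_time_id split: split_indicator\<close>)
  also have "\<dots> = (\<integral>s. indicator {0..t} s *\<^sub>R g (s, trajectory w T \<omega>) \<partial>lborel)"
  proof (rule integral_cong_AE)
    show "AE s in lborel. indicator {0..t} s *\<^sub>R \<xi> (clamp_time T s) \<omega> =
        indicator {0..t} s *\<^sub>R g (s, trajectory w T \<omega>)"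
      using elim(1)
      by eventually_elim (use t in \<open>auto simp: clamp_time_id split: split_indicator\<close>)
  qed measurable
  finally show ?case by (simp add: set_lebesgue_integral_def)
qed

text \<open>
  Fubini: joint measurability allows the exchange of the two almost-everywhere quantifiers.
\<close>
lemma path_functional_of_fixed_times:
  fixes \<xi> :: "real \<Rightarrow> 'w \<Rightarrow> real^'n"
  assumes bm: "standard_brownian_motion P w"
    and \<xi>: "jointly_measurable P T \<xi>"
    and g: "g \<in> borel_measurable (borel \<Otimes>\<^sub>M path_space T)"
    and eq: "\<And>s. s \<in> {0..T} \<Longrightarrow> AE \<omega> in P. \<xi> s \<omega> = g (s, trajectory w T \<omega>)"
  shows "path_functional P w T \<xi> g"
proof -
  interpret prob_space P using bm by (rule bm_prob_space)
  interpret pair_sigma_finite P lborel ..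
  note [measurable] = \<xi>[unfolded jointly_measurable_def] measurable_along_trajectory[OF bm g]
  have "AE s in lborel. AE \<omega> in P. s \<in> {0..T} \<longrightarrow>
      \<xi> (clamp_time T s) \<omega> = g (s, trajectory w T \<omega>)"
  proof (rule AE_I2)
    fix s
    show "AE \<omega> in P. s \<in> {0..T} \<longrightarrow> \<xi> (clamp_time T s) \<omega> = g (s, trajectory w T \<omega>)"
      using eq[of s] by (cases "s \<in> {0..T}") (simp_all only: clamp_time_id, simp_all)
  qed
  then have "AE \<omega> in P. AE s in lborel. s \<in> {0..T} \<longrightarrow>
      \<xi> (clamp_time T s) \<omega> = g (s, trajectory w T \<omega>)"
    by (subst AE_commute) measurable
  then show ?thesis
    unfolding path_functional_def
  proof eventually_elim
    case (elim \<omega>)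
    then show ?case by eventually_elim (auto simp: clamp_time_id)
  qed
qed

context brownian_pair
begin

lemma expectation_transport:
  fixes X :: "'a \<Rightarrow> 'c::{banach, second_countable_topology}"
  assumes "X \<in> borel_measurable P" "X' \<in> borel_measurable Q"
    and f: "f \<in> borel_measurable (path_space T)"
    and "AE \<omega> in P. X \<omega> = f (trajectory w T \<omega>)" "AE \<omega> in Q. X' \<omega> = f (trajectory v T \<omega>)"
  shows "(\<integral>\<omega>. X \<omega> \<partial>P) = (\<integral>\<omega>. X' \<omega> \<partial>Q)"
proof -
  note [measurable] = assms(1-3)
  have "(\<integral>\<omega>. X \<omega> \<partial>P) = (\<integral>\<omega>. f (trajectory w T \<omega>) \<partial>P)"
    by (rule integral_cong_AE) (use assms(4) in measurable)
  also have "\<dots> = (\<integral>\<omega>. f (trajectory v T \<omega>) \<partial>Q)"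
    by (rule integral_transport[OF f])
  also have "\<dots> = (\<integral>\<omega>. X' \<omega> \<partial>Q)"
    by (rule integral_cong_AE) (use assms(5) in \<open>measurable, auto elim: eventually_mono\<close>)
  finally show ?thesis .
qed

lemma expectation_time_integral_transport:
  fixes \<xi> :: "real \<Rightarrow> 'a \<Rightarrow> 'c::{banach, second_countable_topology}"
  assumes "jointly_measurable P T \<xi>" "jointly_measurable Q T \<xi>'"
    and g: "g \<in> borel_measurable (borel \<Otimes>\<^sub>M path_space T)"
    and "path_functional P w T \<xi> g" "path_functional Q v T \<xi>' g"
  shows "(\<integral>\<omega>. (LINT s:{0..T}|lborel. \<xi> s \<omega>) \<partial>P) = (\<integral>\<omega>. (LINT s:{0..T}|lborel. \<xi>' s \<omega>) \<partial>Q)"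
  using assms
  by (intro expectation_transport[where f="\<lambda>x. LINT s:{0..T}|lborel. g (s, x)" and T=T]
      time_integral_measurable time_integral_functional_measurable
      time_integral_functional[OF bmP] time_integral_functional[OF bmQ]) auto

lemma L2_proc_transport:
  fixes \<xi> :: "real \<Rightarrow> 'a \<Rightarrow> real^'n"
  assumes \<xi>: "\<xi> \<in> L2_proc P w T" and prog: "progressive Q v T \<xi>'"
    and g[measurable]: "g \<in> borel_measurable (borel \<Otimes>\<^sub>M path_space T)"
    and \<xi>g: "path_functional P w T \<xi> g" and \<xi>'g: "path_functional Q v T \<xi>' g"
  shows "\<xi>' \<in> L2_proc Q v T"
proof -
  have *: "(\<integral>\<^sup>+\<omega>. (\<integral>\<^sup>+s\<in>{0..T}. ennreal ((norm (\<zeta> s \<omega>))\<^sup>2) \<partial>lborel) \<partial>R) =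
      (\<integral>\<^sup>+\<omega>. (\<integral>\<^sup>+s\<in>{0..T}. ennreal ((norm (g (s, trajectory u T \<omega>)))\<^sup>2) \<partial>lborel) \<partial>R)"
    if "path_functional R u T \<zeta> g"
    for R :: "'r measure" and u :: "real \<Rightarrow> 'r \<Rightarrow> real^'d" and \<zeta> :: "real \<Rightarrow> 'r \<Rightarrow> real^'n"
  proof (rule nn_integral_cong_AE)
    show "AE \<omega> in R. (\<integral>\<^sup>+s\<in>{0..T}. ennreal ((norm (\<zeta> s \<omega>))\<^sup>2) \<partial>lborel) =
       (\<integral>\<^sup>+s\<in>{0..T}. ennreal ((norm (g (s, trajectory u T \<omega>)))\<^sup>2) \<partial>lborel)"
      using that[unfolded path_functional_def]
    proof eventually_elim
      case (elim \<omega>)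
      show ?case
        by (rule nn_integral_cong_AE) (use elim in eventually_elim, auto split: split_indicator)
    qed
  qed
  have "(\<lambda>x. \<integral>\<^sup>+s\<in>{0..T}. ennreal ((norm (g (s, x)))\<^sup>2) \<partial>lborel) \<in> borel_measurable (path_space T)"
    by measurable
  from nn_integral_transport[OF this] show ?thesis
    using \<xi> prog *[OF \<xi>g] *[OF \<xi>'g] by (simp add: L2_proc_def)
qed

text \<open>
  Second moments and mean-square distances between two times are expectations of functionals of
  the trajectory.
\<close>
lemma C_proc_transport:
  fixes y :: "real \<Rightarrow> 'a \<Rightarrow> real^'n"
  assumes y: "y \<in> C_proc P w T" and prog: "progressive Q v T y'"
    and g: "g \<in> borel_measurable (borel \<Otimes>\<^sub>M path_space T)"
    and yg: "\<And>s. s \<in> {0..T} \<Longrightarrow> AE \<omega> in P. y s \<omega> = g (s, trajectory w T \<omega>)"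
    and y'g: "\<And>s. s \<in> {0..T} \<Longrightarrow> AE \<omega> in Q. y' s \<omega> = g (s, trajectory v T \<omega>)"
  shows "y' \<in> C_proc Q v T"
proof -
  have gs[measurable]: "(\<lambda>x. g (s, x)) \<in> borel_measurable (path_space T)" for s
    by (rule measurable_section[OF g])
  have my[measurable]: "y s \<in> borel_measurable P" if "s \<in> {0..T}" for s
    by (rule C_proc_measurable[OF bmP y that])
  have my'[measurable]: "y' s \<in> borel_measurable Q" if "s \<in> {0..T}" for s
    by (rule measurable_from_brownian[OF bmQ progressive_adapted[OF prog that]])
  have int: "integrable Q (\<lambda>\<omega>. (norm (y' s \<omega>))\<^sup>2)" if s: "s \<in> {0..T}" for s
  proof -
    note [measurable] = my[OF s] my'[OF s]
    have "integrable P (\<lambda>\<omega>. (norm (y s \<omega>))\<^sup>2)" using y s by (auto simp: C_proc_def L2_rv_def)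
    also have "?this \<longleftrightarrow> integrable P (\<lambda>\<omega>. (norm (g (s, trajectory w T \<omega>)))\<^sup>2)"
      by (rule integrable_cong_AE) (use yg[OF s] in \<open>measurable, auto elim: eventually_mono\<close>)
    also have "\<dots> \<longleftrightarrow> integrable Q (\<lambda>\<omega>. (norm (g (s, trajectory v T \<omega>)))\<^sup>2)"
      by (rule integrable_transport) measurable
    also have "\<dots> \<longleftrightarrow> integrable Q (\<lambda>\<omega>. (norm (y' s \<omega>))\<^sup>2)"
      by (rule integrable_cong_AE) (use y'g[OF s] in \<open>measurable, auto elim: eventually_mono\<close>)
    finally show ?thesis .
  qed
  have msd: "(\<integral>\<omega>. (norm (y' s \<omega> - y' t \<omega>))\<^sup>2 \<partial>Q) = (\<integral>\<omega>. (norm (y s \<omega> - y t \<omega>))\<^sup>2 \<partial>P)"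
    if s: "s \<in> {0..T}" and t: "t \<in> {0..T}" for s t
  proof (rule expectation_transport[where f="\<lambda>x. (norm (g (s, x) - g (t, x)))\<^sup>2" and T=T, symmetric])
    note [measurable] = my[OF s] my'[OF s] my[OF t] my'[OF t]
    show "(\<lambda>\<omega>. (norm (y s \<omega> - y t \<omega>))\<^sup>2) \<in> borel_measurable P" by measurable
    show "(\<lambda>\<omega>. (norm (y' s \<omega> - y' t \<omega>))\<^sup>2) \<in> borel_measurable Q" by measurable
    show "(\<lambda>x. (norm (g (s, x) - g (t, x)))\<^sup>2) \<in> borel_measurable (path_space T)" by measurable
    show "AE \<omega> in P. (norm (y s \<omega> - y t \<omega>))\<^sup>2 = (norm (g (s, trajectory w T \<omega>) - g (t, trajectory w T \<omega>)))\<^sup>2"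
      using yg[OF s] yg[OF t] by eventually_elim simp
    show "AE \<omega> in Q. (norm (y' s \<omega> - y' t \<omega>))\<^sup>2 = (norm (g (s, trajectory v T \<omega>) - g (t, trajectory v T \<omega>)))\<^sup>2"
      using y'g[OF s] y'g[OF t] by eventually_elim simp
  qed
  have "((\<lambda>s. \<integral>\<omega>. (norm (y' s \<omega> - y' t \<omega>))\<^sup>2 \<partial>Q) \<longlongrightarrow> 0) (at t within {0..T})"
    if t: "t \<in> {0..T}" for t
  proof -
    have "((\<lambda>s. \<integral>\<omega>. (norm (y s \<omega> - y t \<omega>))\<^sup>2 \<partial>P) \<longlongrightarrow> 0) (at t within {0..T})"
      using y t by (simp add: C_proc_def)
    moreover have "\<forall>\<^sub>F s in at t within {0..T}.
        (\<integral>\<omega>. (norm (y s \<omega> - y t \<omega>))\<^sup>2 \<partial>P) = (\<integral>\<omega>. (norm (y' s \<omega> - y' t \<omega>))\<^sup>2 \<partial>Q)"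
      using msd t by (auto simp: eventually_at_filter)
    ultimately show ?thesis by (rule Lim_transform_eventually)
  qed
  moreover have "y' s \<in> borel_measurable (brownian_filtration Q v s)"
    "y' s \<in> borel_measurable (brownian_filtration Q v T)" if "s \<in> {0..T}" for s
    using progressive_adapted[OF prog that] measurable_brownian_mono[of s T "y' s" Q v borel] that by auto
  ultimately show ?thesis
    using int unfolding C_proc_def L2_rv_def by blast
qed

end

section \<open>Transport of solutions and invariance of observability\<close>

lemma borel_measurable_matrix_vector_mult [measurable (raw)]:
  fixes A :: "real^'n^'m"
  assumes "f \<in> borel_measurable M"
  shows "(\<lambda>x. A *v f x) \<in> borel_measurable M"
  using assms by (rule measurable_compose)
    (intro borel_measurable_continuous_onI matrix_vector_mult_linear_continuous_on)

lemma path_functional_combine: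
  fixes Y :: "'i::finite \<Rightarrow> real \<Rightarrow> 'w \<Rightarrow> 'c"
  assumes "path_functional P w T y g" "\<And>i. path_functional P w T (Y i) (gY i)"
  shows "path_functional P w T (\<lambda>s \<omega>. H (y s \<omega>) (\<lambda>i. Y i s \<omega>)) (\<lambda>p. H (g p) (\<lambda>i. gY i p))"
proof -
  have "AE \<omega> in P. \<forall>i. AE s in lborel. s \<in> {0..T} \<longrightarrow> Y i s \<omega> = gY i (s, trajectory w T \<omega>)"
    using assms(2) by (simp add: path_functional_def AE_all_countable)
  with assms(1)[unfolded path_functional_def] show ?thesis
    unfolding path_functional_def
  proof eventually_elim
    case (elim \<omega>)
    have "AE s in lborel. \<forall>i. s \<in> {0..T} \<longrightarrow> Y i s \<omega> = gY i (s, trajectory w T \<omega>)"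
      using elim(2) unfolding AE_all_countable .
    with elim(1) show ?case by eventually_elim simp
  qed
qed

definition dual_drift ::
  "real^'n^'n \<Rightarrow> ('d \<Rightarrow> real^'n^'n) \<Rightarrow> real^'n \<Rightarrow> ('d \<Rightarrow> real^'n) \<Rightarrow> real^'n" where
  "dual_drift A C a b = - (transpose A *v a) - (\<Sum>i\<in>UNIV. transpose (C i) *v b i)"

lemma measurable_dual_drift [measurable]:
  fixes f :: "'a \<Rightarrow> real^'n" and h :: "'d::finite \<Rightarrow> 'a \<Rightarrow> real^'n"
  assumes [measurable]: "f \<in> borel_measurable M" "\<And>i. h i \<in> borel_measurable M"
  shows "(\<lambda>x. dual_drift A C (f x) (\<lambda>i. h i x)) \<in> borel_measurable M"
  unfolding dual_drift_def by measurable

definition output_energy ::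
  "real^'m^'n \<Rightarrow> ('d \<Rightarrow> real^'m^'n) \<Rightarrow> real^'n \<Rightarrow> ('d::finite \<Rightarrow> real^'n) \<Rightarrow> real" where
  "output_energy B D a b = (norm (transpose B *v a + (\<Sum>i\<in>UNIV. transpose (D i) *v b i)))\<^sup>2"

lemma measurable_output_energy [measurable]:
  fixes f :: "'a \<Rightarrow> real^'n" and h :: "'d::finite \<Rightarrow> 'a \<Rightarrow> real^'n"
  assumes [measurable]: "f \<in> borel_measurable M" "\<And>i. h i \<in> borel_measurable M"
  shows "(\<lambda>x. output_energy B D (f x) (\<lambda>i. h i x)) \<in> borel_measurable M"
  unfolding output_energy_def by measurable

context brownian_pair
begin

text \<open>
  The functionals \<open>g\<close> and \<open>gY\<close> describe both solutions, which is what makes their expectations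
  comparable. The new terminal value is the value at \<open>T\<close> of the new process \<open>y'\<close>.
\<close>
lemma dual_solution_transport:
  fixes A :: "real^'n^'n" and C :: "'d \<Rightarrow> real^'n^'n"
  assumes sol: "dual_solution A C P w T y1 y Y" and T: "0 \<le> T"
  obtains g gY y' Y' where
    "g \<in> borel_measurable (borel \<Otimes>\<^sub>M path_space T)"
    "\<forall>i. gY i \<in> borel_measurable (borel \<Otimes>\<^sub>M path_space T)"
    "\<forall>s\<in>{0..T}. AE \<omega> in P. y s \<omega> = g (s, trajectory w T \<omega>)"
    "\<forall>s\<in>{0..T}. AE \<omega> in Q. y' s \<omega> = g (s, trajectory v T \<omega>)"
    "path_functional P w T y g" "path_functional Q v T y' g"
    "\<forall>i. path_functional P w T (Y i) (gY i)" "\<forall>i. path_functional Q v T (Y' i) (gY i)"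
    "dual_solution A C Q v T (y' T) y' Y'"
proof -
  from sol have yC: "y \<in> C_proc P w T" and yprog: "progressive P w T y"
    and YL: "\<And>i. Y i \<in> L2_proc P w T"
    and eq: "\<And>t. t \<in> {0..T} \<Longrightarrow> \<exists>I. (\<forall>i. has_ito_integral P w i (Y i) t (I i)) \<and>
        (AE \<omega> in P. y t \<omega> = y 0 \<omega> + (LINT s:{0..t}|lborel. dual_drift A C (y s \<omega>) (\<lambda>i. Y i s \<omega>))
           + (\<Sum>i\<in>UNIV. I i \<omega>))"
    unfolding dual_solution_def dual_drift_def by auto
  have Yprog: "progressive P w T (Y i)" for i using YL by (simp add: L2_proc_def)
  obtain g where g[measurable]: "g \<in> borel_measurable (borel \<Otimes>\<^sub>M path_space T)"
    and yg: "AE \<omega> in P. \<forall>s\<in>{0..T}. y s \<omega> = g (s, trajectory w T \<omega>)"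
    using progressive_representation[OF yprog T] .
  have "\<forall>i. \<exists>h. h \<in> borel_measurable (borel \<Otimes>\<^sub>M path_space T) \<and>
      (AE \<omega> in P. \<forall>s\<in>{0..T}. Y i s \<omega> = h (s, trajectory w T \<omega>))"
  proof
    fix i
    show "\<exists>h. h \<in> borel_measurable (borel \<Otimes>\<^sub>M path_space T) \<and>
      (AE \<omega> in P. \<forall>s\<in>{0..T}. Y i s \<omega> = h (s, trajectory w T \<omega>))"
      by (rule progressive_representation[OF Yprog T, of i]) blast
  qed
  from choice[OF this] obtain gY where gY[measurable]: "\<And>i. gY i \<in> borel_measurable (borel \<Otimes>\<^sub>M path_space T)"
    and YgY: "\<And>i. AE \<omega> in P. \<forall>s\<in>{0..T}. Y i s \<omega> = gY i (s, trajectory w T \<omega>)"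
    by blast
  have gs[measurable]: "(\<lambda>x. g (s, x)) \<in> borel_measurable (path_space T)" for s
    by (rule measurable_section[OF g])
  have ygs: "AE \<omega> in P. y s \<omega> = g (s, trajectory w T \<omega>)" if "s \<in> {0..T}" for s
    using yg by eventually_elim (use that in blast)
  note yfun = path_functionalI[OF yg] and Yfun = path_functionalI[OF YgY]
  obtain y' where y'prog: "progressive Q v T y'"
    and y'g_all: "\<forall>s\<in>{0..T}. AE \<omega> in Q. y' s \<omega> = g (s, trajectory v T \<omega>)"
    by (rule mean_square_continuous_version[OF yC g yg])
  note y'g = bspec[OF y'g_all]
  have y'fun: "path_functional Q v T y' g"
    by (rule path_functional_of_fixed_times[OF bmQ progressive_imp_jointly_measurable[OF bmQ y'prog T] g y'g])
  have "\<forall>i. \<exists>Z. progressive Q v T Z \<and> path_functional Q v T Z (gY i)"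
  proof
    fix i
    from eq[of T] T obtain X where "has_ito_integral P w i (Y i) T X" by auto
    then obtain f
      where ito: "has_ito_integral Q v i (\<lambda>s \<omega>. gY i (s, trajectory v T \<omega>)) T (\<lambda>\<omega>. f (trajectory v T \<omega>))"
      by (rule has_ito_integral_transport[OF _ T order_refl gY YgY])
    show "\<exists>Z. progressive Q v T Z \<and> path_functional Q v T Z (gY i)"
      unfolding path_functional_def
      by (rule has_ito_integral_progressive_version[OF bmQ ito measurable_along_trajectory[OF bmQ gY]])
         blast
  qed
  from choice[OF this] obtain Y' where Y'prog: "\<And>i. progressive Q v T (Y' i)"
    and Y'fun: "\<And>i. path_functional Q v T (Y' i) (gY i)" by blast
  have "dual_solution A C Q v T (y' T) y' Y'"
    unfolding dual_solution_def
  proof (intro conjI allI ballI)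
    show "y' \<in> C_proc Q v T" by (rule C_proc_transport[OF yC y'prog g ygs y'g])
    show "progressive Q v T y'" by fact
    show "Y' i \<in> L2_proc Q v T" for i
      by (rule L2_proc_transport[OF YL Y'prog gY Yfun Y'fun])
    show "AE \<omega> in Q. y' T \<omega> = y' T \<omega>" by simp
    fix t assume t: "t \<in> {0..T}"
    from eq[OF t] obtain I where I: "\<And>i. has_ito_integral P w i (Y i) t (I i)"
      and yt: "AE \<omega> in P. y t \<omega> = y 0 \<omega> +
        (LINT s:{0..t}|lborel. dual_drift A C (y s \<omega>) (\<lambda>i. Y i s \<omega>)) + (\<Sum>i\<in>UNIV. I i \<omega>)"
      by blast
    have "\<forall>i. \<exists>f. f \<in> borel_measurable (path_space t) \<and>
        (AE \<omega> in P. I i \<omega> = f (trajectory w t \<omega>)) \<and>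
        has_ito_integral Q v i (\<lambda>s \<omega>. gY i (s, trajectory v T \<omega>)) t (\<lambda>\<omega>. f (trajectory v t \<omega>))"
    proof
      fix i
      show "\<exists>f. f \<in> borel_measurable (path_space t) \<and>
        (AE \<omega> in P. I i \<omega> = f (trajectory w t \<omega>)) \<and>
        has_ito_integral Q v i (\<lambda>s \<omega>. gY i (s, trajectory v T \<omega>)) t (\<lambda>\<omega>. f (trajectory v t \<omega>))"
        by (rule has_ito_integral_transport[OF I _ _ gY YgY]) (use t in auto)
    qed
    from choice[OF this] obtain f where f: "\<And>i. f i \<in> borel_measurable (path_space t)"
      and If: "\<And>i. AE \<omega> in P. I i \<omega> = f i (trajectory w t \<omega>)"
      and ito: "\<And>i. has_ito_integral Q v i (\<lambda>s \<omega>. gY i (s, trajectory v T \<omega>)) t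
          (\<lambda>\<omega>. f i (trajectory v t \<omega>))" by blast
    have ito': "has_ito_integral Q v i (Y' i) t (\<lambda>\<omega>. f i (trajectory v t \<omega>))" for i
    proof (rule has_ito_integral_cong[OF ito])
      show "AE \<omega> in Q. AE s in lborel. s \<in> {0..t} \<longrightarrow> Y' i s \<omega> = gY i (s, trajectory v T \<omega>)"
        using Y'fun[of i, unfolded path_functional_def]
      proof eventually_elim
        case (elim \<omega>)
        then show ?case by eventually_elim (use t in auto)
      qed
    qed
    let ?\<gamma> = "\<lambda>p. dual_drift A C (g p) (\<lambda>i. gY i p)"
    have \<gamma>: "?\<gamma> \<in> borel_measurable (borel \<Otimes>\<^sub>M path_space T)" by measurable
    \<comment> \<open>The right-hand side of the equation at time \<open>t\<close>, as a functional of the trajectory.\<close>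
    define R where "R x = g (0, x) + (LINT s:{0..t}|lborel. ?\<gamma> (s, x)) +
        (\<Sum>i\<in>UNIV. f i (restrict x {0..t}))" for x
    have R: "R \<in> borel_measurable (path_space T)"
      unfolding R_def
      using t by (intro borel_measurable_add gs time_integral_functional_measurable[OF \<gamma>]
          borel_measurable_sum measurable_trajectory_restrict[OF f]) auto
    have tT: "t \<le> T" and zero: "0 \<in> {0..T}" using t T by auto
    have "AE \<omega> in P. \<forall>i. I i \<omega> = f i (trajectory w t \<omega>)" using If by (simp add: AE_all_countable)
    moreover have "AE \<omega> in P. (LINT s:{0..t}|lborel. dual_drift A C (y s \<omega>) (\<lambda>i. Y i s \<omega>)) =
        (LINT s:{0..t}|lborel. ?\<gamma> (s, trajectory w T \<omega>))"
    proof (rule time_integral_functional[OF bmP _ tT \<gamma> path_functional_combine[OF yfun Yfun]])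
      show "jointly_measurable P T (\<lambda>s \<omega>. dual_drift A C (y s \<omega>) (\<lambda>i. Y i s \<omega>))"
        using progressive_imp_jointly_measurable[OF bmP yprog T]
          progressive_imp_jointly_measurable[OF bmP Yprog T]
        unfolding jointly_measurable_def by measurable
    qed
    ultimately have "AE \<omega> in P. g (t, trajectory w T \<omega>) = R (trajectory w T \<omega>)"
      using yt ygs[OF t] ygs[OF zero]
      by eventually_elim (simp add: R_def restrict_trajectory[OF tT])
    from AE_eq_transport[OF gs R this]
    have "AE \<omega> in Q. g (t, trajectory v T \<omega>) = R (trajectory v T \<omega>)" .
    moreover have "AE \<omega> in Q. (LINT s:{0..t}|lborel. dual_drift A C (y' s \<omega>) (\<lambda>i. Y' i s \<omega>)) =
        (LINT s:{0..t}|lborel. ?\<gamma> (s, trajectory v T \<omega>))"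
    proof (rule time_integral_functional[OF bmQ _ tT \<gamma> path_functional_combine[OF y'fun Y'fun]])
      show "jointly_measurable Q T (\<lambda>s \<omega>. dual_drift A C (y' s \<omega>) (\<lambda>i. Y' i s \<omega>))"
        using progressive_imp_jointly_measurable[OF bmQ y'prog T]
          progressive_imp_jointly_measurable[OF bmQ Y'prog T]
        unfolding jointly_measurable_def by measurable
    qed
    ultimately have "AE \<omega> in Q. y' t \<omega> = y' 0 \<omega> +
        (LINT s:{0..t}|lborel. dual_drift A C (y' s \<omega>) (\<lambda>i. Y' i s \<omega>)) +
        (\<Sum>i\<in>UNIV. f i (trajectory v t \<omega>))"
      using y'g[OF t] y'g[OF zero]
      by eventually_elim (simp add: R_def restrict_trajectory[OF tT])
    then show "\<exists>I. (\<forall>i. has_ito_integral Q v i (Y' i) t (I i)) \<and>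
        (AE \<omega> in Q. y' t \<omega> = y' 0 \<omega> + (LINT s:{0..t}|lborel.
                - (transpose A *v y' s \<omega>) - (\<Sum>i\<in>UNIV. transpose (C i) *v Y' i s \<omega>))
           + (\<Sum>i\<in>UNIV. I i \<omega>))"
      using ito' unfolding dual_drift_def
      by (intro exI[of _ "\<lambda>i \<omega>. f i (trajectory v t \<omega>)"]) simp
  qed
  show ?thesis by (rule that[OF g allI[OF gY] ballI[OF ygs] y'g_all yfun y'fun allI[OF Yfun] allI[OF Y'fun]]) (assumption, fact)
qed

text \<open>
  Solutions are carried from \<open>(P, w)\<close> to \<open>(Q, v)\<close>, so the inequality comes back from \<open>(Q, v)\<close> to
  \<open>(P, w)\<close>.
\<close>
lemma observability_ineq_transport:
  fixes A :: "real^'n^'n" and B :: "real^'m^'n"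
    and C :: "'d \<Rightarrow> real^'n^'n" and D :: "'d \<Rightarrow> real^'m^'n"
  assumes obs: "observability_ineq A B C D Q v T \<delta> c" and T: "0 \<le> T"
  shows "observability_ineq A B C D P w T \<delta> c"
  unfolding observability_ineq_def
proof (intro ballI allI impI)
  fix y1 :: "'a \<Rightarrow> real^'n" and y Y
  assume y1: "y1 \<in> L2_rv P w T" and sol: "dual_solution A C P w T y1 y Y"
  obtain g gY y' Y' where
    g[measurable]: "g \<in> borel_measurable (borel \<Otimes>\<^sub>M path_space T)"
    and gY: "\<forall>i. gY i \<in> borel_measurable (borel \<Otimes>\<^sub>M path_space T)"
    and yg: "\<forall>s\<in>{0..T}. AE \<omega> in P. y s \<omega> = g (s, trajectory w T \<omega>)"
    and y'g: "\<forall>s\<in>{0..T}. AE \<omega> in Q. y' s \<omega> = g (s, trajectory v T \<omega>)"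
    and yfun: "path_functional P w T y g" "path_functional Q v T y' g"
    and Yfun: "\<forall>i. path_functional P w T (Y i) (gY i)" "\<forall>i. path_functional Q v T (Y' i) (gY i)"
    and sol': "dual_solution A C Q v T (y' T) y' Y'"
    by (rule dual_solution_transport[OF sol T])
  note [measurable] = gY[rule_format]
  have gs[measurable]: "(\<lambda>x. g (s, x)) \<in> borel_measurable (path_space T)" for s
    by (rule measurable_section[OF g])
  have yC: "y \<in> C_proc P w T" and y'C: "y' \<in> C_proc Q v T"
    and terminal: "AE \<omega> in P. y T \<omega> = y1 \<omega>"
    and prog: "progressive P w T y" "progressive Q v T y'"
      "\<And>i. progressive P w T (Y i)" "\<And>i. progressive Q v T (Y' i)"
    using sol sol' by (auto simp: dual_solution_def L2_proc_def)
  have square: "(\<integral>\<omega>. (norm (X \<omega>))\<^sup>2 \<partial>P) = (\<integral>\<omega>. (norm (y' s \<omega>))\<^sup>2 \<partial>Q)"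
    if s: "s \<in> {0..T}" and X: "X \<in> borel_measurable P" "AE \<omega> in P. X \<omega> = y s \<omega>" for X s
  proof (rule expectation_transport[where f="\<lambda>x. (norm (g (s, x)))\<^sup>2" and T=T])
    note [measurable] = X(1) C_proc_measurable[OF bmQ y'C s]
    show "(\<lambda>\<omega>. (norm (X \<omega>))\<^sup>2) \<in> borel_measurable P" by measurable
    show "(\<lambda>\<omega>. (norm (y' s \<omega>))\<^sup>2) \<in> borel_measurable Q" by measurable
    show "(\<lambda>x. (norm (g (s, x)))\<^sup>2) \<in> borel_measurable (path_space T)" by measurable
    show "AE \<omega> in P. (norm (X \<omega>))\<^sup>2 = (norm (g (s, trajectory w T \<omega>)))\<^sup>2"
      using bspec[OF yg s] X(2) by eventually_elim simp
    show "AE \<omega> in Q. (norm (y' s \<omega>))\<^sup>2 = (norm (g (s, trajectory v T \<omega>)))\<^sup>2"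
      using bspec[OF y'g s] by eventually_elim simp
  qed
  have times: "0 \<in> {0..T}" "T \<in> {0..T}" using T by auto
  have y0: "(\<integral>\<omega>. (norm (y 0 \<omega>))\<^sup>2 \<partial>P) = (\<integral>\<omega>. (norm (y' 0 \<omega>))\<^sup>2 \<partial>Q)"
    by (rule square[OF times(1) C_proc_measurable[OF bmP yC times(1)]]) simp
  have yT: "(\<integral>\<omega>. (norm (y1 \<omega>))\<^sup>2 \<partial>P) = (\<integral>\<omega>. (norm (y' T \<omega>))\<^sup>2 \<partial>Q)"
  proof (rule square[OF times(2)])
    show "y1 \<in> borel_measurable P"
      using y1 by (intro measurable_from_brownian[OF bmP]) (auto simp: L2_rv_def)
    show "AE \<omega> in P. y1 \<omega> = y T \<omega>" using terminal by eventually_elim simp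
  qed
  have z: "(\<integral>\<omega>. (LINT t:{0..T}|lborel. (norm (dual_output B D y Y t \<omega>))\<^sup>2) \<partial>P) =
      (\<integral>\<omega>. (LINT t:{0..T}|lborel. (norm (dual_output B D y' Y' t \<omega>))\<^sup>2) \<partial>Q)"
    unfolding dual_output_def output_energy_def[symmetric]
  proof (rule expectation_time_integral_transport)
    show "path_functional P w T (\<lambda>t \<omega>. output_energy B D (y t \<omega>) (\<lambda>i. Y i t \<omega>))
        (\<lambda>p. output_energy B D (g p) (\<lambda>i. gY i p))"
      by (rule path_functional_combine[OF yfun(1) Yfun(1)[rule_format]])
    show "path_functional Q v T (\<lambda>t \<omega>. output_energy B D (y' t \<omega>) (\<lambda>i. Y' i t \<omega>))
        (\<lambda>p. output_energy B D (g p) (\<lambda>i. gY i p))"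
      by (rule path_functional_combine[OF yfun(2) Yfun(2)[rule_format]])
    show "(\<lambda>p. output_energy B D (g p) (\<lambda>i. gY i p)) \<in> borel_measurable (borel \<Otimes>\<^sub>M path_space T)"
      by measurable
    show "jointly_measurable P T (\<lambda>t \<omega>. output_energy B D (y t \<omega>) (\<lambda>i. Y i t \<omega>))"
      using prog(1,3)[THEN progressive_imp_jointly_measurable[OF bmP _ T]]
      unfolding jointly_measurable_def by measurable
    show "jointly_measurable Q T (\<lambda>t \<omega>. output_energy B D (y' t \<omega>) (\<lambda>i. Y' i t \<omega>))"
      using prog(2,4)[THEN progressive_imp_jointly_measurable[OF bmQ _ T]]
      unfolding jointly_measurable_def by measurable
  qed
  have "y' T \<in> L2_rv Q v T" using y'C times by (simp add: C_proc_def)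
  with obs sol' have "(\<integral>\<omega>. (norm (y' 0 \<omega>))\<^sup>2 \<partial>Q)
      \<le> c * (\<integral>\<omega>. (LINT t:{0..T}|lborel. (norm (dual_output B D y' Y' t \<omega>))\<^sup>2) \<partial>Q)
        + \<delta> * (\<integral>\<omega>. (norm (y' T \<omega>))\<^sup>2 \<partial>Q)"
    unfolding observability_ineq_def by blast
  then show "(\<integral>\<omega>. (norm (y 0 \<omega>))\<^sup>2 \<partial>P)
      \<le> c * (\<integral>\<omega>. (LINT t:{0..T}|lborel. (norm (dual_output B D y Y t \<omega>))\<^sup>2) \<partial>P)
        + \<delta> * (\<integral>\<omega>. (norm (y1 \<omega>))\<^sup>2 \<partial>P)"
    unfolding y0 yT z .
qed

end

lemma observability_ineq_invariant:
  fixes w :: "real \<Rightarrow> 'a \<Rightarrow> real^'d" and v :: "real \<Rightarrow> 'b \<Rightarrow> real^'d"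
  assumes "standard_brownian_motion P w" "standard_brownian_motion Q v" "0 \<le> T"
  shows "observability_ineq A B C D P w T \<delta> c \<longleftrightarrow> observability_ineq A B C D Q v T \<delta> c"
proof -
  interpret PQ: brownian_pair P w Q v using assms by unfold_locales
  interpret QP: brownian_pair Q v P w using assms by unfold_locales
  show ?thesis
    using PQ.observability_ineq_transport QP.observability_ineq_transport \<open>0 \<le> T\<close> by blast
qed

theorem theorem3p3:
  fixes N :: "'w measure"
    and A :: "real^'n^'n" and B :: "real^'m^'n"
    and C :: "'d::finite \<Rightarrow> real^'n^'n" and D :: "'d \<Rightarrow> real^'m^'n"
    and T \<delta> :: real
  assumes ex_space: "\<exists>(P :: 'w measure) (w :: real \<Rightarrow> 'w \<Rightarrow> real^'d). filtered_prob_space N P w"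
    and T: "0 < T" and delta: "0 \<le> \<delta>" "\<delta> < 1"
  shows
    "((\<exists>(P :: 'w measure) (w :: real \<Rightarrow> 'w \<Rightarrow> real^'d).
          filtered_prob_space N P w \<and> delta_observable A B C D P w T \<delta>) \<longleftrightarrow>
      (\<forall>(P :: 'w measure) (w :: real \<Rightarrow> 'w \<Rightarrow> real^'d).
          filtered_prob_space N P w \<longrightarrow> delta_observable A B C D P w T \<delta>)) \<and>
     ((\<exists>(P :: 'w measure) (w :: real \<Rightarrow> 'w \<Rightarrow> real^'d).
          filtered_prob_space N P w \<and> delta_observable A B C D P w T \<delta>) \<longrightarrow>
      (\<exists>\<kappa>. \<forall>(P :: 'w measure) (w :: real \<Rightarrow> 'w \<Rightarrow> real^'d).
          filtered_prob_space N P w \<longrightarrow> O_op A B C D P w T \<delta> = \<kappa>))"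
proof -
  obtain P0 :: "'w measure" and w0 :: "real \<Rightarrow> 'w \<Rightarrow> real^'d" where P0: "filtered_prob_space N P0 w0"
    using ex_space by blast
  have inv: "observability_ineq A B C D P w T \<delta> c \<longleftrightarrow> observability_ineq A B C D P0 w0 T \<delta> c"
    if "filtered_prob_space N P w" for P :: "'w measure" and w :: "real \<Rightarrow> 'w \<Rightarrow> real^'d" and c
    using that P0 T unfolding filtered_prob_space_def
    by (intro observability_ineq_invariant) auto
  then have "delta_observable A B C D P w T \<delta> \<longleftrightarrow> delta_observable A B C D P0 w0 T \<delta>"
    and "O_op A B C D P w T \<delta> = O_op A B C D P0 w0 T \<delta>"
    if "filtered_prob_space N P w" for P :: "'w measure" and w :: "real \<Rightarrow> 'w \<Rightarrow> real^'d"
    using that by (simp_all add: delta_observable_def O_op_def)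
  then show ?thesis using P0 by blast
qed

end
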